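(* Let $K$ be a field and $S=K[x_1,\ldots,x_5]$. Then $\operatorname{sdepth}_S I\geq \operatorname{depth}_S I$ for every square free monomial ideal $I\subset S$.
   Context: Let $S=K[x_1,\ldots,x_n]$ be a polynomial ring over a field $K$ and let $M$ be a finitely generated $\mathbb{Z}^n$-graded $S$-module. For a homogeneous element $m\in M$ and a subset $Z\subseteq\{x_1,\ldots,x_n\}$, let $mK[Z]\subset M$ be the $K$-linear subspace of all elements $mf$ with $f\in K[Z]$. It is called a Stanley space of dimension $|Z|$ if $mK[Z]$ is a free $K[Z]$-module. A Stanley decomposition of $M$ is a presentation of the $K$-vector space $M$ as a finite direct sum of Stanley spaces $\mathcal{D}:\ M=\bigoplus_{i=1}^r m_iK[Z_i]$. Put $\operatorname{sdepth}\mathcal{D}=\min\{|Z_i| : i=1,\ldots,r\}$. The Stanley depth is $\operatorname{sdepth}_S M=\max\{\operatorname{sdepth}\mathcal{D} : \mathcal{D}\text{ is a Stanley decomposition of }M\}$. The symbol $\operatorname{depth}_S M$ denotes the usual depth with respect to the graded maximal ideal $(x_1,\ldots,x_n)$. For the zero module, depth and Stanley depth are $\infty$ by convention. A square free monomial ideal is an ideal generated by square free monomials. *)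

theory Defs
  imports "HOL-Library.Poly_Mapping" "HOL-Library.Numeral_Type" "HOL-Library.Extended_Nat"
begin

section \<open>The polynomial ring\<close>

text \<open>
  A finite index type \<open>'n\<close> of variables and a field \<open>'k\<close> give \<open>K[x_i | i :: 'n]\<close> as the finitely
  supported functions from exponent vectors to coefficients; the product of
  \<^theory>\<open>HOL-Library.Poly_Mapping\<close> is convolution, i.e. polynomial multiplication.
\<close>

type_synonym ('n, 'k) mpoly = "('n \<Rightarrow>\<^sub>0 nat) \<Rightarrow>\<^sub>0 'k"

definition monomial :: "('n \<Rightarrow>\<^sub>0 nat) \<Rightarrow> ('n, 'k::field) mpoly" where
  "monomial t = Poly_Mapping.single t 1"

definition var :: "'n \<Rightarrow> ('n, 'k::field) mpoly" where
  "var i = monomial (Poly_Mapping.single i 1)"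

definition subring_in :: "'n set \<Rightarrow> ('n, 'k::field) mpoly set" where \<comment> \<open>\<open>K[Z]\<close>\<close>
  "subring_in Z = {f. \<forall>t\<in>Poly_Mapping.keys f. Poly_Mapping.keys t \<subseteq> Z}"

lemma module_mult: "module ((*) :: 'a::comm_ring_1 \<Rightarrow> 'a \<Rightarrow> 'a)"
  by standard (simp_all add: algebra_simps)

definition ideal_generated :: "'a::comm_ring_1 set \<Rightarrow> 'a set" where
  "ideal_generated = module.span (*)"

definition squarefree_monomial_ideal :: "('n, 'k::field) mpoly set \<Rightarrow> bool" where
  "squarefree_monomial_ideal I \<longleftrightarrow>
     (\<exists>T. (\<forall>t\<in>T. \<forall>i. Poly_Mapping.lookup t i \<le> 1) \<and> I = ideal_generated (monomial ` T))"

definition graded_maximal_ideal :: "('n, 'k::field) mpoly set" where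
  "graded_maximal_ideal = ideal_generated (range var)"

text \<open>The standard \<open>\<int>\<^sup>n\<close>-grading of \<open>S\<close>; a component is \<open>{0}\<close> if some entry of its degree is negative.\<close>

definition component :: "('n \<Rightarrow> int) \<Rightarrow> ('n, 'k::field) mpoly set" where
  "component a = {f. \<forall>t\<in>Poly_Mapping.keys f. \<forall>i. int (Poly_Mapping.lookup t i) = a i}"


section \<open>Depth\<close>

text \<open>
  From here on, modules are submodules \<open>M\<close> of an ambient module given by a scalar multiplication
  \<open>scale\<close> on a type \<open>'b\<close>. An ideal is a submodule of \<open>S\<close> with \<open>scale = (*)\<close>.
\<close>

definition ideal_times :: "('r::comm_ring_1 \<Rightarrow> 'b \<Rightarrow> 'b) \<Rightarrow> 'r set \<Rightarrow> 'b set \<Rightarrow> 'b::ab_group_add set"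
  where \<comment> \<open>the submodule \<open>(F)M\<close>, for generators \<open>F\<close> of an ideal\<close>
  "ideal_times scale F M = module.span scale {scale f m | f m. f \<in> F \<and> m \<in> M}"

text \<open>
  The first conjunct says that \<open>fs ! i\<close> is a nonzerodivisor on \<open>M/(fs ! 0, \<dots>, fs ! (i-1))M\<close>.
\<close>

definition regular_sequence :: "('r::comm_ring_1 \<Rightarrow> 'b \<Rightarrow> 'b) \<Rightarrow> 'b::ab_group_add set \<Rightarrow> 'r list \<Rightarrow> bool"
  where
  "regular_sequence scale M fs \<longleftrightarrow>
     (\<forall>i<length fs. \<forall>m\<in>M. scale (fs ! i) m \<in> ideal_times scale (set (take i fs)) M \<longrightarrow>
        m \<in> ideal_times scale (set (take i fs)) M) \<and>
     ideal_times scale (set fs) M \<noteq> M"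

definition depth :: "(('n, 'k::field) mpoly \<Rightarrow> 'b \<Rightarrow> 'b) \<Rightarrow> 'b::ab_group_add set \<Rightarrow> enat" where
  "depth scale M = (if M = {0} then \<infinity> else
     Sup {enat (length fs) | fs. set fs \<subseteq> graded_maximal_ideal \<and> regular_sequence scale M fs})"


section \<open>Stanley depth\<close>

definition free_over :: "('r::comm_ring_1 \<Rightarrow> 'b \<Rightarrow> 'b) \<Rightarrow> 'r set \<Rightarrow> 'b::ab_group_add set \<Rightarrow> bool"
  where \<comment> \<open>\<open>N\<close> has a basis as a module over the subring \<open>R\<close>\<close>
  "free_over scale R N \<longleftrightarrow>
     (\<exists>B. N = {\<Sum>b\<in>F. scale (c b) b | F c. finite F \<and> F \<subseteq> B \<and> (\<forall>b\<in>F. c b \<in> R)} \<and>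
          (\<forall>F c. finite F \<and> F \<subseteq> B \<and> (\<forall>b\<in>F. c b \<in> R) \<and> (\<Sum>b\<in>F. scale (c b) b) = 0 \<longrightarrow>
             (\<forall>b\<in>F. c b = 0)))"

definition direct_sum_decomp :: "'b::ab_group_add set \<Rightarrow> nat \<Rightarrow> (nat \<Rightarrow> 'b set) \<Rightarrow> bool" where
  "direct_sum_decomp M r V \<longleftrightarrow>
     M = {\<Sum>i<r. v i | v. \<forall>i<r. v i \<in> V i} \<and>
     (\<forall>v. (\<forall>i<r. v i \<in> V i) \<and> (\<Sum>i<r. v i) = 0 \<longrightarrow> (\<forall>i<r. v i = 0))"

definition mK :: "(('n, 'k::field) mpoly \<Rightarrow> 'b \<Rightarrow> 'b) \<Rightarrow> 'b \<times> 'n set \<Rightarrow> 'b::ab_group_add set" where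
  "mK scale = (\<lambda>(m, Z). (\<lambda>f. scale f m) ` subring_in Z)"

text \<open>
  \<open>G\<close> is the family of homogeneous components of the ambient module, so that the homogeneous
  elements of the graded submodule \<open>M\<close> of degree \<open>a\<close> are \<open>M \<inter> G a\<close>. A decomposition lists the
  pairs \<open>(m\<^sub>i, Z\<^sub>i)\<close>.
\<close>

definition stanley_space ::
  "(('n, 'k::field) mpoly \<Rightarrow> 'b \<Rightarrow> 'b) \<Rightarrow> (('n \<Rightarrow> int) \<Rightarrow> 'b set) \<Rightarrow> 'b::ab_group_add set \<Rightarrow>
   'b \<times> 'n set \<Rightarrow> bool" where
  "stanley_space scale G M mZ \<longleftrightarrow>
     (\<exists>a. fst mZ \<in> M \<inter> G a) \<and> free_over scale (subring_in (snd mZ)) (mK scale mZ)"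

definition stanley_decomposition ::
  "(('n, 'k::field) mpoly \<Rightarrow> 'b \<Rightarrow> 'b) \<Rightarrow> (('n \<Rightarrow> int) \<Rightarrow> 'b set) \<Rightarrow> 'b::ab_group_add set \<Rightarrow>
   ('b \<times> 'n set) list \<Rightarrow> bool" where
  "stanley_decomposition scale G M D \<longleftrightarrow>
     (\<forall>mZ\<in>set D. stanley_space scale G M mZ) \<and>
     direct_sum_decomp M (length D) (\<lambda>i. mK scale (D ! i))"

definition sdepth_decomp :: "('b \<times> 'n::finite set) list \<Rightarrow> enat" where
  "sdepth_decomp D = (INF mZ\<in>set D. enat (card (snd mZ)))"

definition sdepth ::
  "(('n::finite, 'k::field) mpoly \<Rightarrow> 'b \<Rightarrow> 'b) \<Rightarrow> (('n \<Rightarrow> int) \<Rightarrow> 'b set) \<Rightarrow>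
   'b::ab_group_add set \<Rightarrow> enat" where
  "sdepth scale G M = (if M = {0} then \<infinity> else
     Sup {sdepth_decomp D | D. stanley_decomposition scale G M D})"

end

theory Submission
  imports Defs
begin

text \<open>
  A squarefree monomial ideal \<open>I\<close> is spanned by the monomials whose support lies in an upward closed
  family \<open>\<U>\<close> of sets of variables. A disjoint decomposition of \<open>\<U>\<close> into intervals \<open>[A, B]\<close> of the
  Boolean lattice is a Stanley decomposition of \<open>I\<close> into the spaces \<open>x\<^sup>A K[B]\<close>; it therefore suffices
  to partition \<open>\<U>\<close> into intervals whose upper ends have at least \<open>depth I\<close> elements.

  \<^item> In five variables every \<open>\<U>\<close> has a partition with upper ends of size at least \<open>3\<close>
    (\<open>interval_partitionable_3\<close>): if \<open>\<emptyset> \<notin> \<U>\<close>, the nonempty sets with at most three elements fall into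
    five blocks, permuted by the cyclic group, and each block can be partitioned on its own. This
    settles depth at most \<open>3\<close>.
  \<^item> For \<open>n\<close> variables and depth at least \<open>n - 1\<close> the depth has to be used. An \<open>I\<close>-regular sequence of
    length \<open>d\<close> in the maximal ideal makes the Koszul cohomology of \<open>I\<close> vanish in degrees below \<open>d\<close>
    (\<open>regular_sequence_koszul_acyclic\<close>), and vanishing in a given degree is inherited by the colon
    ideals \<open>I : x\<^sup>A\<close> (\<open>koszul_acyclic_localize\<close>). Consider the simplicial complex formed by the
    complements of the sets in \<open>\<U>\<close>. A minimal nonface with at least three vertices, or an induced
    cycle of length at least four in its graph, would give after passing to a colon ideal a cocycle of
    degree at most \<open>n - 2\<close> that is not a coboundary (\<open>koszul_acyclic_insert\<close>,
    \<open>koszul_acyclic_chord\<close>). Hence the complex is the clique complex of a chordal graph. Eliminating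
    simplicial vertices one at a time, as in Dirac's theorem, partitions its nonempty faces into
    intervals with a single vertex as lower end; taking complements, \<open>\<U>\<close> is partitioned into intervals
    with upper ends of size at least \<open>n - 1\<close>.
  \<^item> If the depth is \<open>n\<close>, minimal nonfaces with two vertices are excluded as well, so the complex is a
    simplex and \<open>\<U>\<close> is a single interval \<open>[A, V]\<close>, with \<open>V\<close> the set of all variables. A depth larger than
    \<open>n\<close> is impossible, because a minimal generator gives a nonzero class in degree \<open>n\<close>
    (\<open>not_koszul_acyclic_card\<close>).

  Each of these cocycles has integer coefficients and is detected by a coefficient \<open>\<plusminus>1\<close>, so the
  characteristic of \<open>K\<close> does not matter.
\<close>

section \<open>Squarefree monomial ideals and upward closed families\<close>

interpretation ideal: module "(*) :: 'a::comm_ring_1 \<Rightarrow> 'a \<Rightarrow> 'a"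
  by (rule module_mult)

\<comment> \<open>This rule reassociates products to the left and does not terminate together with \<open>mult.assoc\<close>.\<close>
declare ideal.scale_scale [simp del]

abbreviation is_ideal :: "'a::comm_ring_1 set \<Rightarrow> bool" where
  "is_ideal \<equiv> module.subspace (*)"

lemma lookup_monomial_mult: "Poly_Mapping.lookup (monomial s * f) (s + t) = Poly_Mapping.lookup f t"
  by (simp add: monomial_def lookup_mult lookup_single when_mult)

lemma lookup_monomial_mult_zero:
  assumes "\<And>q. t \<noteq> s + q"
  shows "Poly_Mapping.lookup (monomial s * f) t = 0"
  using assms by (simp add: monomial_def lookup_mult lookup_single when_mult)

lemma lookup_var_mult:
  "Poly_Mapping.lookup (var j * f) t =
     (if Poly_Mapping.lookup t j = 0 then 0
      else Poly_Mapping.lookup f (t - Poly_Mapping.single j 1))"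
proof (cases "Poly_Mapping.lookup t j = 0")
  case True
  then have "t \<noteq> Poly_Mapping.single j 1 + q" for q by (auto simp: lookup_add)
  then show ?thesis using True by (simp add: var_def lookup_monomial_mult_zero)
next
  case False
  have "t = Poly_Mapping.single j 1 + (t - Poly_Mapping.single j 1)"
    using False by (intro poly_mapping_eqI) (auto simp: lookup_add lookup_minus lookup_single when_def)
  then show ?thesis using False by (metis var_def lookup_monomial_mult)
qed

lemma lookup_monomial: "Poly_Mapping.lookup (monomial s) t = (if t = s then 1 else 0)"
  by (auto simp: monomial_def lookup_single when_def)

lemma keys_add_exponents: "Poly_Mapping.keys (s + t) = Poly_Mapping.keys s \<union> Poly_Mapping.keys t"
  for s t :: "'n \<Rightarrow>\<^sub>0 nat"
  by (auto simp: in_keys_iff lookup_add)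

definition upward_closed :: "'n set set \<Rightarrow> bool" where
  "upward_closed \<U> \<longleftrightarrow> (\<forall>A\<in>\<U>. \<forall>B. A \<subseteq> B \<longrightarrow> B \<in> \<U>)"

lemma upward_closedD: "upward_closed \<U> \<Longrightarrow> A \<in> \<U> \<Longrightarrow> A \<subseteq> B \<Longrightarrow> B \<in> \<U>"
  by (auto simp: upward_closed_def)

text \<open>
  The \<open>K\<close>-span of the monomials with support in \<open>\<F>\<close>: a squarefree monomial ideal if \<open>\<F>\<close> is upward
  closed, and the Stanley space \<open>x\<^sup>A K[B]\<close> if \<open>\<F>\<close> is the interval \<open>[A, B]\<close>.
\<close>

definition polys_on :: "'n set set \<Rightarrow> ('n, 'k::field) mpoly set" where
  "polys_on \<F> = {f. \<forall>t\<in>Poly_Mapping.keys f. Poly_Mapping.keys t \<in> \<F>}"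

lemma polys_on_iff:
  "f \<in> polys_on \<F> \<longleftrightarrow> (\<forall>t. Poly_Mapping.keys t \<notin> \<F> \<longrightarrow> Poly_Mapping.lookup f t = 0)"
  by (auto simp: polys_on_def in_keys_iff)

lemma polys_on_empty: "polys_on {} = {0}"
  by (auto simp: polys_on_iff intro: poly_mapping_eqI)

lemma polys_on_mono: "\<F> \<subseteq> \<G> \<Longrightarrow> polys_on \<F> \<subseteq> polys_on \<G>"
  by (auto simp: polys_on_def)

lemma monomial_in_polys_on: "monomial t \<in> polys_on \<F> \<longleftrightarrow> Poly_Mapping.keys t \<in> \<F>"
  by (auto simp: polys_on_def monomial_def)

lemma is_ideal_polys_on:
  assumes "upward_closed \<U>"
  shows "is_ideal (polys_on \<U> :: ('n, 'k::field) mpoly set)"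
proof (rule ideal.subspaceI)
  fix f g :: "('n, 'k) mpoly" assume g: "g \<in> polys_on \<U>"
  show "f * g \<in> polys_on \<U>"
    unfolding polys_on_def
  proof (intro CollectI ballI)
    fix t assume "t \<in> Poly_Mapping.keys (f * g)"
    then obtain a b where t: "t = a + b" "b \<in> Poly_Mapping.keys g"
      using keys_mult[of f g] by blast
    then have "Poly_Mapping.keys b \<in> \<U>" using g by (auto simp: polys_on_def)
    then show "Poly_Mapping.keys t \<in> \<U>"
      using assms t by (auto simp: keys_add_exponents intro: upward_closedD)
  qed
qed (auto simp: polys_on_iff lookup_add)

lemma squarefree_monomial_ideal_polys_on:
  fixes I :: "('n, 'k::field) mpoly set"
  assumes "squarefree_monomial_ideal I"
  obtains \<U> where "upward_closed \<U>" "I = polys_on \<U>"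
proof -
  obtain T where T: "\<And>t i. t \<in> T \<Longrightarrow> Poly_Mapping.lookup t i \<le> 1"
    and I: "I = ideal_generated (monomial ` T)"
    using assms unfolding squarefree_monomial_ideal_def by blast
  define \<U> where "\<U> = {Y. \<exists>t\<in>T. Poly_Mapping.keys t \<subseteq> Y}"
  have up: "upward_closed \<U>" by (fastforce simp: upward_closed_def \<U>_def)
  have "I \<subseteq> polys_on \<U>"
    unfolding I ideal_generated_def
  proof (rule ideal.span_minimal)
    show "monomial ` T \<subseteq> (polys_on \<U> :: ('n, 'k) mpoly set)"
      by (auto simp: monomial_in_polys_on \<U>_def)
  qed (rule is_ideal_polys_on[OF up])
  moreover have "f \<in> I" if f: "f \<in> polys_on \<U>" for f
  proof -
    have "f = (\<Sum>t\<in>Poly_Mapping.keys f. Poly_Mapping.single t (Poly_Mapping.lookup f t))"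
      by (intro poly_mapping_eqI)
         (auto simp: lookup_sum lookup_single when_def sum.delta in_keys_iff)
    also have "\<dots> \<in> I"
      unfolding I ideal_generated_def
    proof (rule ideal.span_sum)
      fix t assume "t \<in> Poly_Mapping.keys f"
      then obtain s where s: "s \<in> T" "Poly_Mapping.keys s \<subseteq> Poly_Mapping.keys t"
        using f by (auto simp: polys_on_def \<U>_def)
      \<comment> \<open>\<open>s\<close> is squarefree, so containment of supports already means divisibility.\<close>
      have "Poly_Mapping.lookup s i \<le> Poly_Mapping.lookup t i" for i
        using T[OF s(1), of i] s(2)
        by (cases "Poly_Mapping.lookup s i = 0")
           (auto simp: in_keys_iff subset_iff intro: order_trans[OF _ Suc_leI])
      then have "t = (t - s) + s"
        by (intro poly_mapping_eqI) (simp add: lookup_add lookup_minus)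
      then have "Poly_Mapping.single t (Poly_Mapping.lookup f t)
          = Poly_Mapping.single (t - s) (Poly_Mapping.lookup f t) * monomial s"
        by (simp add: monomial_def mult_single)
      also have "\<dots> \<in> module.span (*) (monomial ` T)"
        by (intro ideal.span_scale ideal.span_base imageI s)
      finally show "Poly_Mapping.single t (Poly_Mapping.lookup f t) \<in> module.span (*) (monomial ` T)" .
    qed
    finally show ?thesis .
  qed
  ultimately show ?thesis using that up by blast
qed



section \<open>The Koszul complex\<close>

definition koszul_sign :: "'n::linorder \<Rightarrow> 'n set \<Rightarrow> 'r::comm_ring_1" where
  "koszul_sign j Z = (- 1) ^ card {l \<in> Z. l < j}"

text \<open>
  The differential of the Koszul complex of \<open>x\<^sub>1, \<dots>, x\<^sub>n\<close>. A cochain of degree \<open>i\<close> consists of the values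
  on the \<open>i\<close>-element sets \<open>Z\<close>; taking functions on all sets avoids domain conditions, and statements
  about degree \<open>i\<close> look only at those values.
\<close>

definition koszul_d ::
  "('n::{finite,linorder} set \<Rightarrow> ('n, 'k::field) mpoly) \<Rightarrow> 'n set \<Rightarrow> ('n, 'k) mpoly" where
  "koszul_d c Z = (\<Sum>j\<in>Z. koszul_sign j Z * var j * c (Z - {j}))"

lemma koszul_sign_square [simp]: "koszul_sign j Z * koszul_sign j Z = (1 :: 'r::comm_ring_1)"
  by (cases "even (card {l \<in> Z. l < j})") (simp_all add: koszul_sign_def)

lemma koszul_sign_square_left [simp]: "koszul_sign j Z * (koszul_sign j Z * f) = (f :: 'r::comm_ring_1)"
  by (metis koszul_sign_square mult.assoc mult_1)

lemma koszul_sign_self [simp]: "koszul_sign j (Z - {j}) = koszul_sign j Z"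
  "koszul_sign j (insert j Z) = koszul_sign j Z"
  unfolding koszul_sign_def
  by (rule arg_cong[where f = "\<lambda>X. (- 1) ^ card X"], auto)+

lemma koszul_sign_insert:
  fixes Z :: "'n::{finite,linorder} set"
  assumes "l \<notin> Z"
  shows "koszul_sign j (insert l Z) = (if l < j then - koszul_sign j Z else koszul_sign j Z :: 'r::comm_ring_1)"
proof (cases "l < j")
  case True
  then have "{m \<in> insert l Z. m < j} = insert l {m \<in> Z. m < j}" by auto
  then show ?thesis using True assms by (simp add: koszul_sign_def)
next
  case False
  then have "{m \<in> insert l Z. m < j} = {m \<in> Z. m < j}" by auto
  then show ?thesis using False by (simp add: koszul_sign_def)
qed

lemma koszul_sign_swap:
  fixes Z :: "'n::{finite,linorder} set"
  assumes "j \<in> Z" "l \<in> Z" "j \<noteq> l"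
  shows "koszul_sign l Z * koszul_sign j (Z - {l}) =
    - (koszul_sign j Z * koszul_sign l (Z - {j}) :: 'r::comm_ring_1)"
proof -
  define Y where "Y = Z - {j, l}"
  have Z: "Z = insert j (insert l Y)" "Z - {l} = insert j Y" "Z - {j} = insert l Y"
    and Y: "j \<notin> Y" "l \<notin> Y" using assms by (auto simp: Y_def)
  have 1: "koszul_sign j Z = (if l < j then - koszul_sign j Y else koszul_sign j Y :: 'r)"
    unfolding Z koszul_sign_self by (rule koszul_sign_insert[OF Y(2)])
  have 2: "koszul_sign l Z = (if j < l then - koszul_sign l Y else koszul_sign l Y :: 'r)"
    unfolding Z insert_commute[of j l] koszul_sign_self by (rule koszul_sign_insert[OF Y(1)])
  show ?thesis using assms(3) unfolding 1 2 Z(2,3) koszul_sign_self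
    by (cases j l rule: linorder_cases) (auto simp: mult.commute)
qed

lemma koszul_d_cong:
  assumes "\<And>Y. Suc (card Y) = card Z \<Longrightarrow> b Y = c Y"
  shows "koszul_d b Z = koszul_d c Z"
  unfolding koszul_d_def
proof (rule sum.cong)
  fix j assume "j \<in> Z"
  then have "Suc (card (Z - {j})) = card Z" by (intro card_Suc_Diff1) simp_all
  then show "koszul_sign j Z * var j * b (Z - {j}) = koszul_sign j Z * var j * c (Z - {j})"
    using assms by simp
qed simp

lemma koszul_d_add: "koszul_d (\<lambda>Z. b Z + c Z) Z = koszul_d b Z + koszul_d c Z"
  by (simp add: koszul_d_def ring_distribs sum.distrib)

lemma koszul_d_diff: "koszul_d (\<lambda>Z. b Z - c Z) Z = koszul_d b Z - koszul_d c Z"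
  by (simp add: koszul_d_def ring_distribs sum_subtractf)

lemma koszul_d_mult: "koszul_d (\<lambda>Z. f * c Z) Z = f * koszul_d c Z"
  by (simp add: koszul_d_def sum_distrib_left ac_simps)

lemma koszul_d_in:
  assumes "is_ideal M" "\<And>j. j \<in> Z \<Longrightarrow> c (Z - {j}) \<in> M"
  shows "koszul_d c Z \<in> M"
  unfolding koszul_d_def by (intro ideal.subspace_sum ideal.subspace_scale assms)


text \<open>
  Removing \<open>j\<close> and \<open>l\<close> in either order contributes opposite terms. The double sum is split into \<open>l < j\<close>
  and \<open>j < l\<close> rather than compared with its own negative, so that characteristic \<open>2\<close> is included.
\<close>

lemma koszul_d_d: "koszul_d (koszul_d c) Z = 0"
proof -
  define g where "g j l = koszul_sign j Z * koszul_sign l (Z - {j}) * (var j * var l * c (Z - {j, l}))" for j l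
  have g: "g l j = - g j l" if "j \<in> Z" "l \<in> Z" "j \<noteq> l" for j l
    using koszul_sign_swap[OF that, where 'r = "('a, 'b) mpoly"]
    by (simp add: g_def insert_commute[of l j] mult.commute[of "var l" "var j"])
  have "koszul_d (koszul_d c) Z = (\<Sum>j\<in>Z. \<Sum>l\<in>Z - {j}. g j l)"
    unfolding koszul_d_def g_def sum_distrib_left
    by (intro sum.cong refl) (simp add: mult_ac Diff_insert2[symmetric])
  also have "\<dots> = (\<Sum>j\<in>Z. (\<Sum>l\<in>{l\<in>Z. l < j}. g j l) + (\<Sum>l\<in>{l\<in>Z. j < l}. g j l))"
    by (intro sum.cong[OF refl], subst sum.union_disjoint[symmetric])
       (simp, simp, force, intro sum.cong refl, force)
  also have "\<dots> = (\<Sum>j\<in>Z. \<Sum>l\<in>{l\<in>Z. l < j}. g j l) + (\<Sum>j\<in>Z. \<Sum>l\<in>{l\<in>Z. j < l}. g j l)"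
    by (rule sum.distrib)
  also have "(\<Sum>j\<in>Z. \<Sum>l\<in>{l\<in>Z. j < l}. g j l) = (\<Sum>l\<in>Z. \<Sum>j\<in>{j\<in>Z. j < l}. g j l)"
    by (rule sum.swap_restrict) auto
  also have "\<dots> = - (\<Sum>l\<in>Z. \<Sum>j\<in>{j\<in>Z. j < l}. g l j)"
    unfolding sum_negf[symmetric] by (intro sum.cong refl g) auto
  finally show ?thesis by simp
qed


text \<open>
  Contraction with the basis vector of \<open>x\<^sub>l\<close>, which shows that multiplication by \<open>x\<^sub>l\<close> is null-homotopic.
\<close>

definition koszul_homotopy ::
  "'n::{finite,linorder} \<Rightarrow> ('n set \<Rightarrow> ('n, 'k::field) mpoly) \<Rightarrow> 'n set \<Rightarrow> ('n, 'k) mpoly" where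
  "koszul_homotopy l c Z = (if l \<in> Z then 0 else koszul_sign l Z * c (insert l Z))"

lemma koszul_homotopy:
  "koszul_d (koszul_homotopy l c) Z + koszul_homotopy l (koszul_d c) Z = var l * c Z"
proof (cases "l \<in> Z")
  case True
  have "koszul_d (koszul_homotopy l c) Z = (\<Sum>j\<in>Z. if j = l then var l * c Z else 0)"
    unfolding koszul_d_def
    by (intro sum.cong refl) (auto simp: koszul_homotopy_def True insert_absorb ac_simps)
  then show ?thesis using True by (simp add: koszul_homotopy_def)
next
  case False
  have *: "koszul_sign j Z * var j * koszul_homotopy l c (Z - {j}) =
      - (koszul_sign l Z * (koszul_sign j (insert l Z) * var j * c (insert l Z - {j})))"
    if j: "j \<in> Z" for j
  proof -
    have [simp]: "j \<noteq> l" "insert l Z - {j} = insert l (Z - {j})" using j False by auto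
    have "koszul_sign l (insert l Z) * koszul_sign j (insert l Z - {l}) =
      - (koszul_sign j (insert l Z) * koszul_sign l (insert l Z - {j}) :: ('a, 'b) mpoly)"
      by (rule koszul_sign_swap) (use j in auto)
    then have "koszul_sign l Z * koszul_sign j Z =
      - (koszul_sign j (insert l Z) * koszul_sign l (Z - {j}) :: ('a, 'b) mpoly)"
      using False by simp
    then have "koszul_sign l Z * (koszul_sign l Z * koszul_sign j Z) * koszul_sign l (Z - {j}) =
      koszul_sign l Z * - (koszul_sign j (insert l Z) * koszul_sign l (Z - {j})) * koszul_sign l (Z - {j} :: 'a set)
      * (1 :: ('a, 'b) mpoly)"
      by simp
    then have "koszul_sign j Z * koszul_sign l (Z - {j}) =
      - (koszul_sign l Z * koszul_sign j (insert l Z) :: ('a, 'b) mpoly)"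
      by (simp add: mult.assoc)
    then have "koszul_sign j Z * koszul_sign l (Z - {j}) * (var j * c (insert l (Z - {j}))) =
      - (koszul_sign l Z * koszul_sign j (insert l Z)) * (var j * c (insert l (Z - {j})))"
      by simp
    then show ?thesis using False by (simp add: koszul_homotopy_def ac_simps)
  qed
  have "koszul_d (koszul_homotopy l c) Z =
      - (koszul_sign l Z * (\<Sum>j\<in>Z. koszul_sign j (insert l Z) * var j * c (insert l Z - {j})))"
    unfolding koszul_d_def sum_distrib_left sum_negf[symmetric] by (intro sum.cong refl *)
  moreover have "koszul_homotopy l (koszul_d c) Z = koszul_sign l Z * (koszul_sign l Z * var l * c Z +
      (\<Sum>j\<in>Z. koszul_sign j (insert l Z) * var j * c (insert l Z - {j})))"
    using False by (simp add: koszul_homotopy_def koszul_d_def)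
  ultimately show ?thesis by (simp add: distrib_left mult.assoc)
qed

section \<open>Regular sequences and Koszul cohomology\<close>

text \<open>
  Multiplication by \<open>f = \<Sum>\<^sub>l r\<^sub>l x\<^sub>l\<close> is null-homotopic through the combination \<open>e\<close> of the contractions
  of \<open>c\<close> with coefficients \<open>r\<^sub>l\<close>: the error \<open>f c - d e\<close> is made of values of \<open>d c\<close> one degree higher.
  With \<open>N\<close> it says that \<open>f\<close> annihilates the cohomology of \<open>M/N\<close>.
\<close>

lemma graded_maximal_ideal_homotopy:
  fixes c :: "'n::{finite,linorder} set \<Rightarrow> ('n, 'k::field) mpoly"
  assumes "f \<in> graded_maximal_ideal" "is_ideal M" "is_ideal N"
    and c: "\<And>Z. c Z \<in> M" "\<And>Z. card Z = Suc i \<Longrightarrow> koszul_d c Z \<in> N"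
  obtains e where "\<And>Z. e Z \<in> M" "\<And>Z. card Z = i \<Longrightarrow> f * c Z - koszul_d e Z \<in> N"
proof -
  have "f \<in> module.span (*) (range var)"
    using assms(1) by (simp add: graded_maximal_ideal_def ideal_generated_def)
  then have "\<exists>e. (\<forall>Z. e Z \<in> M) \<and> (\<forall>Z. card Z = i \<longrightarrow> f * c Z - koszul_d e Z \<in> N)"
  proof (induction rule: ideal.span_induct_alt)
    case base
    show ?case
      by (rule exI[of _ "\<lambda>_. 0"])
         (simp add: koszul_d_def ideal.subspace_0[OF assms(2)] ideal.subspace_0[OF assms(3)])
  next
    case (step r x f)
    then obtain e l where e: "\<And>Z. e Z \<in> M" "\<And>Z. card Z = i \<Longrightarrow> f * c Z - koszul_d e Z \<in> N"
      and x: "x = var l" by blast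
    define h where "h Z = r * koszul_homotopy l c Z + e Z" for Z
    have "h Z \<in> M" for Z
      unfolding h_def koszul_homotopy_def
      by (auto intro!: ideal.subspace_add ideal.subspace_scale assms c e ideal.subspace_0)
    moreover have "(r * x + f) * c Z - koszul_d h Z \<in> N" if Z: "card Z = i" for Z
    proof -
      have "koszul_d h Z = r * koszul_d (koszul_homotopy l c) Z + koszul_d e Z"
        unfolding h_def koszul_d_add koszul_d_mult ..
      also have "koszul_d (koszul_homotopy l c) Z = x * c Z - koszul_homotopy l (koszul_d c) Z"
        unfolding x koszul_homotopy[symmetric, of l c Z] by simp
      finally have "(r * x + f) * c Z - koszul_d h Z =
          r * koszul_homotopy l (koszul_d c) Z + (f * c Z - koszul_d e Z)"
        by (simp add: algebra_simps)
      moreover have "koszul_homotopy l (koszul_d c) Z \<in> N"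
        using Z by (auto simp: koszul_homotopy_def intro!: assms ideal.subspace_0 ideal.subspace_scale)
      ultimately show ?thesis
        using e(2)[OF Z] by (auto intro!: ideal.subspace_add ideal.subspace_scale assms)
    qed
    ultimately show ?case by blast
  qed
  then show ?thesis using that by blast
qed

text \<open>
  Exactness in degree \<open>i\<close> of the Koszul cochain complex of \<open>M/N\<close>, with cochains lifted to \<open>M\<close>.
\<close>

definition koszul_exact :: "('n::{finite,linorder}, 'k::field) mpoly set \<Rightarrow> ('n, 'k) mpoly set \<Rightarrow> nat \<Rightarrow> bool" where
  "koszul_exact M N i \<longleftrightarrow>
    (\<forall>c. (\<forall>Z. c Z \<in> M) \<and> (\<forall>Z. card Z = Suc i \<longrightarrow> koszul_d c Z \<in> N) \<longrightarrow>
      (\<exists>b. (\<forall>Z. b Z \<in> M) \<and> (\<forall>Z. card Z = i \<longrightarrow> c Z - koszul_d b Z \<in> N)))"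

lemma is_ideal_ideal_times: "is_ideal (ideal_times (*) F M)"
  by (simp add: ideal_times_def)

lemma ideal_times_insert:
  assumes "is_ideal M" "x \<in> ideal_times (*) (insert f F) M"
  obtains h where "h \<in> M" "x - f * h \<in> ideal_times (*) F M"
proof -
  have "x \<in> module.span (*) {g * m | g m. g \<in> insert f F \<and> m \<in> M}"
    using assms by (simp add: ideal_times_def)
  then have "\<exists>h\<in>M. x - f * h \<in> ideal_times (*) F M"
  proof (induction rule: ideal.span_induct_alt)
    case base
    show ?case
      by (rule bexI[of _ 0]) (simp_all add: ideal.subspace_0 assms is_ideal_ideal_times)
  next
    case (step r x y)
    then obtain h g m where h: "h \<in> M" "y - f * h \<in> ideal_times (*) F M"
      and x: "x = g * m" "g \<in> insert f F" "m \<in> M" by blast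
    show ?case
    proof (cases "g = f")
      case True
      have "r * x + y - f * (r * m + h) = y - f * h" by (simp add: x True algebra_simps)
      moreover have "r * m + h \<in> M"
        by (intro ideal.subspace_add ideal.subspace_scale assms x h)
      ultimately show ?thesis using h(2) by metis
    next
      case False
      then have "x \<in> ideal_times (*) F M"
        using x unfolding ideal_times_def by (intro ideal.span_base) blast
      then have "r * x + (y - f * h) \<in> ideal_times (*) F M"
        by (intro ideal.subspace_add ideal.subspace_scale is_ideal_ideal_times h)
      then show ?thesis using h by (intro bexI[of _ h]) (simp_all add: algebra_simps)
    qed
  qed
  then show ?thesis using that by blast
qed



text \<open>
  The vanishing of Koszul cohomology below the length of a regular sequence, for all the quotients
  \<open>M/N\<close> with \<open>N = (f\<^sub>1, \<dots>, f\<^sub>p)M\<close> at once. Let \<open>f\<close> be the next element and \<open>N' = N + fM\<close>. For a cocycle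
  \<open>c\<close> modulo \<open>N\<close> the homotopy gives \<open>f c = d e\<close> modulo \<open>N\<close>, so \<open>e\<close> is a cocycle modulo \<open>N'\<close> of degree one
  less, and by induction \<open>e = d b + f h\<close> modulo \<open>N\<close>. Then \<open>f (c - d h)\<close> lies in \<open>N\<close>, and \<open>f\<close> cancels
  because it is regular on \<open>M/N\<close>. In degree \<open>0\<close> there is no \<open>e\<close>, and \<open>f c\<close> lies in \<open>N\<close> at once.
\<close>

lemma regular_sequence_koszul_exact:
  fixes M :: "('n::{finite,linorder}, 'k::field) mpoly set"
  assumes M: "is_ideal M" and fs: "set fs \<subseteq> graded_maximal_ideal"
    and reg: "\<And>p m. p < length fs \<Longrightarrow> m \<in> M \<Longrightarrow> fs ! p * m \<in> ideal_times (*) (set (take p fs)) M \<Longrightarrow>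
      m \<in> ideal_times (*) (set (take p fs)) M"
  shows "p + i < length fs \<Longrightarrow> koszul_exact M (ideal_times (*) (set (take p fs)) M) i"
proof (induction i arbitrary: p)
  case 0
  let ?N = "ideal_times (*) (set (take p fs)) M"
  show ?case unfolding koszul_exact_def
  proof (intro allI impI, elim conjE)
    fix c assume c: "\<forall>Z. c Z \<in> M" "\<forall>Z. card Z = Suc 0 \<longrightarrow> koszul_d c Z \<in> ?N"
    have "fs ! p \<in> graded_maximal_ideal" using fs 0 by auto
    from graded_maximal_ideal_homotopy[OF this M is_ideal_ideal_times c(1)[rule_format] c(2)[rule_format]]
    obtain e where "\<And>Z. card Z = 0 \<Longrightarrow> fs ! p * c Z - koszul_d e Z \<in> ?N" by metis
    from this[of "{}"] have "fs ! p * c {} \<in> ?N" by (simp add: koszul_d_def)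
    then have "c {} \<in> ?N" using reg 0 c by simp
    then show "\<exists>b. (\<forall>Z. b Z \<in> M) \<and> (\<forall>Z. card Z = 0 \<longrightarrow> c Z - koszul_d b Z \<in> ?N)"
      using c by (intro exI[of _ c]) (auto simp: koszul_d_def)
  qed
next
  case (Suc i)
  let ?f = "fs ! p"
  let ?N = "ideal_times (*) (set (take p fs)) M"
  let ?N' = "ideal_times (*) (set (take (Suc p) fs)) M"
  have p: "p < length fs" using Suc.prems by simp
  have N': "?N' = ideal_times (*) (insert ?f (set (take p fs))) M"
    using p by (simp add: take_Suc_conv_app_nth)
  have sub: "?N \<subseteq> ?N'" unfolding N' by (unfold ideal_times_def) (rule ideal.span_mono, blast)
  have fN': "?f * m \<in> ?N'" if "m \<in> M" for m
    unfolding N' by (unfold ideal_times_def) (rule ideal.span_base, use that in blast)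
  note N = is_ideal_ideal_times
  show ?case unfolding koszul_exact_def
  proof (intro allI impI, elim conjE)
    fix c assume c: "\<forall>Z. c Z \<in> M" "\<forall>Z. card Z = Suc (Suc i) \<longrightarrow> koszul_d c Z \<in> ?N"
    have "?f \<in> graded_maximal_ideal" using fs p by auto
    from graded_maximal_ideal_homotopy[OF this M is_ideal_ideal_times c(1)[rule_format] c(2)[rule_format]]
    obtain e where e: "\<And>Z. e Z \<in> M" "\<And>Z. card Z = Suc i \<Longrightarrow> ?f * c Z - koszul_d e Z \<in> ?N"
      by metis
    have "koszul_d e Z \<in> ?N'" if "card Z = Suc i" for Z
    proof -
      have "?f * c Z - (?f * c Z - koszul_d e Z) \<in> ?N'"
        by (intro ideal.subspace_diff N fN' c(1)[rule_format] subsetD[OF sub] e(2) that)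
      then show ?thesis by simp
    qed
    moreover have "koszul_exact M ?N' i" using Suc.IH[of "Suc p"] Suc.prems by simp
    ultimately obtain b where b: "\<And>Z. b Z \<in> M" "\<And>Z. card Z = i \<Longrightarrow> e Z - koszul_d b Z \<in> ?N'"
      using e(1) unfolding koszul_exact_def by metis
    have "\<exists>h. h \<in> M \<and> (card Z = i \<longrightarrow> e Z - koszul_d b Z - ?f * h \<in> ?N)" for Z
    proof (cases "card Z = i")
      case True
      show ?thesis by (rule ideal_times_insert[OF M b(2)[OF True, unfolded N']]) blast
    qed (use ideal.subspace_0[OF M] in blast)
    then obtain h where h: "\<And>Z. h Z \<in> M" "\<And>Z. card Z = i \<Longrightarrow> e Z - koszul_d b Z - ?f * h Z \<in> ?N"
      by metis
    have "c Z - koszul_d h Z \<in> ?N" if Z: "card Z = Suc i" for Z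
    proof (rule reg[OF p])
      show "c Z - koszul_d h Z \<in> M"
        using c h M by (intro ideal.subspace_diff koszul_d_in) auto
      have "koszul_d (\<lambda>Z. e Z - koszul_d b Z - ?f * h Z) Z \<in> ?N"
        using h Z by (intro koszul_d_in N) (auto simp: card_Diff_singleton)
      then have "koszul_d e Z - ?f * koszul_d h Z \<in> ?N"
        by (simp add: koszul_d_diff koszul_d_mult koszul_d_d)
      then have "(?f * c Z - koszul_d e Z) + (koszul_d e Z - ?f * koszul_d h Z) \<in> ?N"
        by (intro ideal.subspace_add N e Z)
      then show "?f * (c Z - koszul_d h Z) \<in> ?N" by (simp add: algebra_simps)
    qed
    then show "\<exists>b. (\<forall>Z. b Z \<in> M) \<and> (\<forall>Z. card Z = Suc i \<longrightarrow> c Z - koszul_d b Z \<in> ?N)"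
      using h by blast
  qed
qed



definition koszul_acyclic :: "('n::{finite,linorder}, 'k::field) mpoly set \<Rightarrow> nat \<Rightarrow> bool" where
  "koszul_acyclic M i \<longleftrightarrow> koszul_exact M {0} i"

lemma koszul_acyclicE:
  assumes "koszul_acyclic M i" "\<And>Z. c Z \<in> M" "\<And>Z. card Z = Suc i \<Longrightarrow> koszul_d c Z = 0"
  obtains b where "\<And>Z. b Z \<in> M" "\<And>Z. card Z = i \<Longrightarrow> c Z = koszul_d b Z"
  using assms unfolding koszul_acyclic_def koszul_exact_def by (metis right_minus_eq singleton_iff)

lemma koszul_acyclicI:
  assumes "\<And>c. (\<And>Z. c Z \<in> M) \<Longrightarrow> (\<And>Z. card Z = Suc i \<Longrightarrow> koszul_d c Z = 0) \<Longrightarrow>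
    \<exists>b. (\<forall>Z. b Z \<in> M) \<and> (\<forall>Z. card Z = i \<longrightarrow> c Z = koszul_d b Z)"
  shows "koszul_acyclic M i"
  using assms unfolding koszul_acyclic_def koszul_exact_def by (metis right_minus_eq singleton_iff)

lemma regular_sequence_koszul_acyclic:
  assumes "is_ideal M" "set fs \<subseteq> graded_maximal_ideal" "regular_sequence (*) M fs" "i < length fs"
  shows "koszul_acyclic M i"
  using regular_sequence_koszul_exact[of M fs 0 i] assms
  by (simp add: koszul_acyclic_def regular_sequence_def ideal_times_def)


section \<open>Passing to colon ideals\<close>

text \<open>
  The family of the colon ideal \<open>I : x\<^sup>A\<close>. In the complex of complements this is the restriction to the
  vertices outside \<open>A\<close>.
\<close>

definition localize :: "'n set \<Rightarrow> 'n set set \<Rightarrow> 'n set set" where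
  "localize A \<U> = {Y. A \<union> Y \<in> \<U>}"

lemma upward_closed_localize: "upward_closed \<U> \<Longrightarrow> upward_closed (localize A \<U>)"
  unfolding upward_closed_def localize_def by (metis Un_mono mem_Collect_eq subset_refl)

lemma split_off_var:
  fixes f :: "('n, 'k::field) mpoly"
  obtains p e where "f = p + var v * e"
    "\<And>t. Poly_Mapping.lookup p t = (if Poly_Mapping.lookup t v = 0 then Poly_Mapping.lookup f t else 0)"
    "\<And>t. Poly_Mapping.lookup e t = Poly_Mapping.lookup f (t + Poly_Mapping.single v 1)"
proof -
  let ?s = "\<lambda>t. t + Poly_Mapping.single v (1::nat)"
  define e where "e = Poly_Mapping.map_key ?s f"
  have "inj ?s" by (auto intro: injI)
  then have e: "Poly_Mapping.lookup e t = Poly_Mapping.lookup f (?s t)" for t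
    by (simp add: e_def map_key.rep_eq)
  have "?s (t - Poly_Mapping.single v 1) = t" if "Poly_Mapping.lookup t v \<noteq> 0" for t
    using that by (intro poly_mapping_eqI) (auto simp: lookup_add lookup_minus lookup_single when_def)
  then have "Poly_Mapping.lookup (f - var v * e) t =
      (if Poly_Mapping.lookup t v = 0 then Poly_Mapping.lookup f t else 0)" for t
    by (auto simp: lookup_minus lookup_var_mult e)
  then show ?thesis using that[of "f - var v * e" e] e by simp
qed



text \<open>
  Let \<open>c\<close> be a cocycle with values in \<open>I : x\<^sub>v\<close>. Then \<open>x\<^sub>v c\<close> has values in \<open>I\<close>, hence \<open>x\<^sub>v c = d b\<close> for some
  \<open>I\<close>-valued \<open>b\<close>. Write \<open>b = p + x\<^sub>v e\<close> with \<open>p\<close> free of \<open>x\<^sub>v\<close>; then \<open>x\<^sub>v (c - d e) = d p\<close>. The only summand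
  of \<open>d p\<close> at \<open>Z\<close> that is divisible by \<open>x\<^sub>v\<close> is \<open>\<plusminus>x\<^sub>v p(Z - {v})\<close>, so \<open>c - d e\<close> is again an \<open>I\<close>-valued
  cocycle, and therefore a coboundary of an \<open>I\<close>-valued cochain \<open>a\<close>. Altogether \<open>c = d (e + a)\<close>.
\<close>

lemma koszul_acyclic_localize_var:
  fixes \<U> :: "'n::{finite,linorder} set set"
  assumes up: "upward_closed \<U>" and ac: "koszul_acyclic (polys_on \<U> :: ('n, 'k::field) mpoly set) i"
  shows "koszul_acyclic (polys_on (localize {v} \<U>) :: ('n, 'k) mpoly set) i"
proof (rule koszul_acyclicI)
  let ?I = "polys_on \<U> :: ('n, 'k) mpoly set"
  let ?J = "polys_on (localize {v} \<U>) :: ('n, 'k) mpoly set"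
  have sub: "?I \<subseteq> ?J"
    using up by (intro polys_on_mono) (auto simp: localize_def elim: upward_closedD)
  have J: "is_ideal ?J" by (intro is_ideal_polys_on upward_closed_localize up)
  fix c :: "'n set \<Rightarrow> ('n, 'k) mpoly"
  assume c: "\<And>Z. c Z \<in> ?J" "\<And>Z. card Z = Suc i \<Longrightarrow> koszul_d c Z = 0"
  have "var v * c Z \<in> ?I" for Z
    unfolding polys_on_iff
  proof (intro allI impI)
    fix t :: "'n \<Rightarrow>\<^sub>0 nat" assume t: "Poly_Mapping.keys t \<notin> \<U>"
    show "Poly_Mapping.lookup (var v * c Z) t = 0"
    proof (cases "Poly_Mapping.lookup t v = 0")
      case False
      then have "Poly_Mapping.keys t = insert v (Poly_Mapping.keys (t - Poly_Mapping.single v 1))"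
        by (auto simp: in_keys_iff lookup_minus lookup_single when_def split: if_splits)
      then show ?thesis using t c(1)[of Z] by (auto simp: polys_on_iff lookup_var_mult localize_def)
    qed (simp add: lookup_var_mult)
  qed
  then obtain b where b: "\<And>Z. b Z \<in> ?I" "\<And>Z. card Z = i \<Longrightarrow> var v * c Z = koszul_d b Z"
    by (rule koszul_acyclicE[OF ac, of "\<lambda>Z. var v * c Z"]) (auto simp: koszul_d_mult c)
  have "\<exists>p e. b Z = p + var v * e \<and>
    (\<forall>t. Poly_Mapping.lookup p t = (if Poly_Mapping.lookup t v = 0 then Poly_Mapping.lookup (b Z) t else 0)) \<and>
    (\<forall>t. Poly_Mapping.lookup e t = Poly_Mapping.lookup (b Z) (t + Poly_Mapping.single v 1))" for Z
    by (rule split_off_var[of "b Z" v]) blast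
  then obtain p e where pe: "b Z = p Z + var v * e Z"
    and p: "Poly_Mapping.lookup (p Z) t = (if Poly_Mapping.lookup t v = 0 then Poly_Mapping.lookup (b Z) t else 0)"
    and e: "Poly_Mapping.lookup (e Z) t = Poly_Mapping.lookup (b Z) (t + Poly_Mapping.single v 1)" for Z t
    by metis
  have eJ: "e Z \<in> ?J" for Z
    using b(1)[of Z] by (auto simp: polys_on_iff e localize_def keys_add_exponents)
  have pI: "p Z \<in> ?I" for Z
    using b(1)[of Z] by (auto simp: polys_on_iff p)
  define r where "r Z = (if v \<in> Z then koszul_sign v Z * p (Z - {v}) else 0)" for Z
  have rI: "r Z \<in> ?I" for Z
    using pI is_ideal_polys_on[OF up]
    by (auto simp: r_def intro!: ideal.subspace_scale ideal.subspace_0)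
  have r: "c Z - koszul_d e Z = r Z" if Z: "card Z = i" for Z
  proof -
    have eq: "var v * (c Z - koszul_d e Z) = koszul_d p Z"
      using b(2)[OF Z] unfolding pe koszul_d_add koszul_d_mult by (simp add: algebra_simps)
    show ?thesis
    proof (rule poly_mapping_eqI)
      fix t :: "'n \<Rightarrow>\<^sub>0 nat"
      let ?t = "t + Poly_Mapping.single v 1"
      have "Poly_Mapping.lookup (c Z - koszul_d e Z) t = Poly_Mapping.lookup (var v * (c Z - koszul_d e Z)) ?t"
        by (simp add: lookup_var_mult lookup_add)
      also have "\<dots> = (\<Sum>j\<in>Z. Poly_Mapping.lookup (var j * (koszul_sign j Z * p (Z - {j}))) ?t)"
        unfolding eq by (simp add: koszul_d_def lookup_sum ac_simps)
      also have "\<dots> = (\<Sum>j\<in>Z. if j = v then Poly_Mapping.lookup (r Z) t else 0)"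
      proof (intro sum.cong refl)
        fix j assume "j \<in> Z"
        have sgn: "Poly_Mapping.lookup (koszul_sign j Z * q) s = koszul_sign j Z * Poly_Mapping.lookup q s"
          for q :: "('n, 'k) mpoly" and s
          by (cases "even (card {l \<in> Z. l < j})") (simp_all add: koszul_sign_def)
        show "Poly_Mapping.lookup (var j * (koszul_sign j Z * p (Z - {j}))) ?t =
          (if j = v then Poly_Mapping.lookup (r Z) t else 0)"
          using \<open>j \<in> Z\<close>
          by (auto simp: lookup_var_mult r_def sgn p lookup_add lookup_minus lookup_single when_def)
      qed
      also have "\<dots> = Poly_Mapping.lookup (r Z) t"
        by (simp add: r_def)
      finally show "Poly_Mapping.lookup (c Z - koszul_d e Z) t = Poly_Mapping.lookup (r Z) t" .
    qed
  qed
  have coc: "koszul_d r Z = 0" if Z: "card Z = Suc i" for Z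
  proof -
    have "koszul_d r Z = koszul_d (\<lambda>Z. c Z - koszul_d e Z) Z"
      using Z by (intro koszul_d_cong) (simp add: r)
    then show ?thesis using c(2)[OF Z] by (simp add: koszul_d_diff koszul_d_d)
  qed
  obtain a where a: "\<And>Z. a Z \<in> ?I" "\<And>Z. card Z = i \<Longrightarrow> r Z = koszul_d a Z"
    by (rule koszul_acyclicE[OF ac, of r]) (use rI coc in auto)
  have "e Z + a Z \<in> ?J" for Z
    using eJ a(1) sub by (intro ideal.subspace_add J) auto
  moreover have "c Z = koszul_d (\<lambda>Z. e Z + a Z) Z" if "card Z = i" for Z
    using r[OF that] a(2)[OF that] by (simp add: koszul_d_add algebra_simps)
  ultimately show "\<exists>b. (\<forall>Z. b Z \<in> ?J) \<and> (\<forall>Z. card Z = i \<longrightarrow> c Z = koszul_d b Z)"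
    by (intro exI[of _ "\<lambda>Z. e Z + a Z"]) blast
qed

lemma koszul_acyclic_localize:
  fixes \<U> :: "'n::{finite,linorder} set set"
  assumes up: "upward_closed \<U>" and ac: "koszul_acyclic (polys_on \<U> :: ('n, 'k::field) mpoly set) i"
  shows "koszul_acyclic (polys_on (localize A \<U>) :: ('n, 'k) mpoly set) i"
proof -
  have "finite A" by simp
  then show ?thesis
  proof induction
    case empty
    then show ?case using ac by (simp add: localize_def)
  next
    case (insert v A)
    have "localize (insert v A) \<U> = localize {v} (localize A \<U>)"
      by (simp add: localize_def insert_commute)
    then show ?case using koszul_acyclic_localize_var[OF upward_closed_localize[OF up] insert.IH] by simp
  qed
qed

section \<open>Cohomological obstructions\<close>

lemma lookup_koszul_sign_mult:
  "Poly_Mapping.lookup (koszul_sign j Z * f) t = koszul_sign j Z * Poly_Mapping.lookup (f :: ('n::linorder, 'k::field) mpoly) t"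
  by (cases "even (card {l \<in> Z. l < j})") (simp_all add: koszul_sign_def)

lemma koszul_sign_nonzero: "koszul_sign j Z \<noteq> (0 :: 'k::field)"
  by (simp add: koszul_sign_def)

definition squarefree_exponent :: "'n::finite set \<Rightarrow> 'n \<Rightarrow>\<^sub>0 nat" where
  "squarefree_exponent A = (\<Sum>i\<in>A. Poly_Mapping.single i 1)"

lemma lookup_squarefree_exponent:
  "Poly_Mapping.lookup (squarefree_exponent A) i = (if i \<in> A then 1 else 0)"
  by (simp add: squarefree_exponent_def lookup_sum lookup_single when_def)

lemma keys_squarefree_exponent [simp]: "Poly_Mapping.keys (squarefree_exponent A) = A"
  by (auto simp: in_keys_iff lookup_squarefree_exponent split: if_splits)

lemma squarefree_exponent_minus_single:
  "squarefree_exponent A - Poly_Mapping.single j 1 = squarefree_exponent (A - {j})"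
  by (intro poly_mapping_eqI) (auto simp: lookup_minus lookup_squarefree_exponent lookup_single when_def)

lemma var_mult_squarefree:
  assumes "j \<in> A"
  shows "var j * monomial (squarefree_exponent (A - {j})) = (monomial (squarefree_exponent A) :: ('n::finite, 'k::field) mpoly)"
proof -
  have "squarefree_exponent A = Poly_Mapping.single j 1 + squarefree_exponent (A - {j})"
    using assms unfolding squarefree_exponent_def by (intro sum.remove) auto
  then show ?thesis by (simp add: var_def monomial_def mult_single)
qed

lemma lookup_koszul_d_squarefree:
  "Poly_Mapping.lookup (koszul_d c Z) (squarefree_exponent A) =
    (\<Sum>j\<in>Z \<inter> A. koszul_sign j Z * Poly_Mapping.lookup (c (Z - {j})) (squarefree_exponent (A - {j})))"
proof -
  have "Poly_Mapping.lookup (koszul_d c Z) (squarefree_exponent A) =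
    (\<Sum>j\<in>Z. if j \<in> A then koszul_sign j Z * Poly_Mapping.lookup (c (Z - {j})) (squarefree_exponent (A - {j})) else 0)"
    unfolding koszul_d_def lookup_sum mult.assoc lookup_koszul_sign_mult lookup_var_mult
      lookup_squarefree_exponent squarefree_exponent_minus_single
    by (intro sum.cong) auto
  also have "\<dots> = (\<Sum>j\<in>Z \<inter> A. koszul_sign j Z * Poly_Mapping.lookup (c (Z - {j})) (squarefree_exponent (A - {j})))"
    by (subst sum.inter_restrict) auto
  finally show ?thesis .
qed

text \<open>
  The criterion used to recognize cocycles that are not coboundaries: the coefficient of \<open>x\<^sup>A\<close> in \<open>d b\<close> at
  \<open>Z\<close> comes from the coefficients of the \<open>x\<^bsup>A - {j}\<^esup>\<close> in \<open>b\<close>.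
\<close>

lemma lookup_coboundary_zero:
  assumes "\<And>Z. b Z \<in> polys_on \<U>" "\<And>j. j \<in> Z \<inter> A \<Longrightarrow> A - {j} \<notin> \<U>"
  shows "Poly_Mapping.lookup (koszul_d b Z) (squarefree_exponent A) = 0"
  unfolding lookup_koszul_d_squarefree
  using assms by (intro sum.neutral) (auto simp: polys_on_iff)

text \<open>
  A minimal generator of \<open>I\<close>, placed on the set of all variables, is a cocycle for degree reasons and not
  a coboundary by minimality.
\<close>

lemma not_koszul_acyclic_card:
  fixes \<U> :: "'n::{finite,linorder} set set"
  assumes "\<U> \<noteq> {}"
  shows "\<not> koszul_acyclic (polys_on \<U> :: ('n, 'k::field) mpoly set) CARD('n)"
proof
  assume ac: "koszul_acyclic (polys_on \<U> :: ('n, 'k) mpoly set) CARD('n)"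
  obtain Y where Y: "Y \<in> \<U>" "\<And>X. X \<in> \<U> \<Longrightarrow> X \<subseteq> Y \<Longrightarrow> X = Y"
    using finite_has_minimal[of \<U>] assms by auto
  let ?y = "monomial (squarefree_exponent Y) :: ('n, 'k) mpoly"
  have "card Z \<noteq> Suc CARD('n)" for Z :: "'n set"
    using card_mono[of UNIV Z] by auto
  then obtain b where b: "\<And>Z. b Z \<in> polys_on \<U>"
      "\<And>Z::'n set. card Z = CARD('n) \<Longrightarrow> ?y = koszul_d b Z"
    using koszul_acyclicE[OF ac, of "\<lambda>_. ?y"] Y(1) by (auto simp: monomial_in_polys_on)
  have "Poly_Mapping.lookup (koszul_d b UNIV) (squarefree_exponent Y) = 0"
    by (rule lookup_coboundary_zero[OF b(1)]) (use Y in blast)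
  then show False using b(2)[of UNIV] by (metis lookup_monomial zero_neq_one)
qed

text \<open>
  Otherwise \<open>- A\<close> would be a minimal nonface: \<open>J = I : x\<^sup>A\<close> contains all \<open>x\<^sub>j\<close> with \<open>j \<notin> A\<close> but not
  \<open>1\<close>. The differential of the cochain that is \<open>1\<close> on \<open>A\<close> and \<open>0\<close> elsewhere has then values in \<open>J\<close>, but it is
  not the differential of a \<open>J\<close>-valued cochain, because \<open>J\<close> has no constant terms.
\<close>

lemma koszul_acyclic_insert:
  fixes \<U> :: "'n::{finite,linorder} set set"
  assumes ac: "koszul_acyclic (polys_on (localize A \<U>) :: ('n, 'k::field) mpoly set) (Suc (card A))"
    and up: "upward_closed \<U>" and A: "A \<notin> \<U>" "A \<noteq> UNIV"
  shows "\<exists>j. j \<notin> A \<and> insert j A \<notin> \<U>"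
proof (rule ccontr)
  assume "\<not> ?thesis"
  then have ins: "insert j A \<in> \<U>" if "j \<notin> A" for j using that by blast
  let ?J = "polys_on (localize A \<U>) :: ('n, 'k) mpoly set"
  have J: "is_ideal ?J" by (intro is_ideal_polys_on upward_closed_localize up)
  define z :: "'n set \<Rightarrow> ('n, 'k) mpoly" where "z Z = (if Z = A then 1 else 0)" for Z
  have "koszul_d z Z \<in> ?J" for Z
    unfolding koszul_d_def
  proof (intro ideal.subspace_sum J)
    fix j assume "j \<in> Z"
    show "koszul_sign j Z * var j * z (Z - {j}) \<in> ?J"
    proof (cases "Z - {j} = A")
      case True
      then have "var j \<in> ?J"
        using ins[of j] by (auto simp: var_def monomial_in_polys_on localize_def)
      then have "koszul_sign j Z * var j \<in> ?J" by (rule ideal.subspace_scale[OF J])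
      then show ?thesis using True by (simp add: z_def)
    qed (simp add: z_def ideal.subspace_0[OF J])
  qed
  then obtain b where b: "\<And>Z. b Z \<in> ?J" "\<And>Z. card Z = Suc (card A) \<Longrightarrow> koszul_d z Z = koszul_d b Z"
    using koszul_acyclicE[OF ac, of "koszul_d z"] by (auto simp: koszul_d_d)
  obtain j where j: "j \<notin> A" using A(2) by auto
  have "koszul_d z (insert j A) = koszul_d b (insert j A)" using j by (intro b) simp
  moreover have "Poly_Mapping.lookup (koszul_d b (insert j A)) (squarefree_exponent {j}) = 0"
    by (rule lookup_coboundary_zero[OF b(1)]) (use A(1) in \<open>auto simp: localize_def\<close>)
  moreover have "Poly_Mapping.lookup (koszul_d z (insert j A)) (squarefree_exponent {j}) = koszul_sign j (insert j A)"
    using j unfolding lookup_koszul_d_squarefree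
    by (simp add: z_def squarefree_exponent_def lookup_one)
  ultimately show False using koszul_sign_nonzero[of j "insert j A", where 'k = 'k] by simp
qed



text \<open>
  The graph of the complex of complements, whose faces are the sets \<open>- Y\<close> with \<open>Y \<in> \<U>\<close>.
\<close>

definition adjacent :: "'n set set \<Rightarrow> 'n \<Rightarrow> 'n \<Rightarrow> bool" where
  "adjacent \<U> p q \<longleftrightarrow> p \<noteq> q \<and> - {p, q} \<in> \<U>"

lemma adjacent_sym: "adjacent \<U> p q \<Longrightarrow> adjacent \<U> q p"
  by (metis adjacent_def insert_commute)

text \<open>
  In the multidegree given by \<open>\<sigma>\<close> the Koszul cochains on complements of faces are the simplicial chains
  of the complex, up to signs: a face \<open>\<tau>\<close> corresponds to the monomial \<open>x\<^bsup>\<sigma> - \<tau>\<^esup>\<close> on \<open>- \<tau>\<close>. The factors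
  below are chosen such that the edge \<open>p q\<close> has the boundary \<open>p - q\<close>, so that paths can be added up.
\<close>

definition edge_cochain :: "'n::{finite,linorder} set \<Rightarrow> 'n \<Rightarrow> 'n \<Rightarrow> 'n set \<Rightarrow> ('n, 'k::field) mpoly" where
  "edge_cochain \<sigma> p q Z = (if Z = - {p, q} then
     koszul_sign p UNIV * koszul_sign q (- {p}) * monomial (squarefree_exponent (\<sigma> - {p, q})) else 0)"

definition vertex_cochain :: "'n::{finite,linorder} set \<Rightarrow> 'n \<Rightarrow> 'n set \<Rightarrow> ('n, 'k::field) mpoly" where
  "vertex_cochain \<sigma> p Z = (if Z = - {p} then
     koszul_sign p UNIV * monomial (squarefree_exponent (\<sigma> - {p})) else 0)"

lemma koszul_d_edge_cochain:
  fixes \<sigma> :: "'n::{finite,linorder} set"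
  assumes "p \<in> \<sigma>" "q \<in> \<sigma>" "p \<noteq> q"
  shows "koszul_d (edge_cochain \<sigma> p q) Z =
    (vertex_cochain \<sigma> p Z - vertex_cochain \<sigma> q Z :: ('n, 'k::field) mpoly)"
proof -
  let ?E = "edge_cochain \<sigma> p q :: 'n set \<Rightarrow> ('n, 'k) mpoly"
  \<comment> \<open>at most one summand of the differential meets the support of the edge cochain\<close>
  have single: "koszul_d ?E Z = koszul_sign j Z * var j * ?E (- {p, q})"
    if "j \<in> Z" "Z - {j} = - {p, q}" for j
  proof -
    have "koszul_d ?E Z = (\<Sum>l\<in>Z. if l = j then koszul_sign j Z * var j * ?E (- {p, q}) else 0)"
      unfolding koszul_d_def
    proof (intro sum.cong refl)
      fix l assume "l \<in> Z"
      show "koszul_sign l Z * var l * ?E (Z - {l}) =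
          (if l = j then koszul_sign j Z * var j * ?E (- {p, q}) else 0)"
      proof (cases "l = j")
        case False
        then have "Z - {l} \<noteq> - {p, q}" using that \<open>l \<in> Z\<close> by blast
        then show ?thesis using False by (simp add: edge_cochain_def)
      qed (simp add: that)
    qed
    then show ?thesis using that by simp
  qed
  consider (p) "Z = - {p}" | (q) "Z = - {q}" | (neither) "Z \<noteq> - {p}" "Z \<noteq> - {q}" by blast
  then show ?thesis
  proof cases
    case p
    have "q \<in> Z" "Z - {q} = - {p, q}" using p assms by auto
    note single[OF this]
    also have "koszul_sign q Z * var q * ?E (- {p, q}) =
        koszul_sign q Z * koszul_sign q Z * (koszul_sign p UNIV *
          (var q * monomial (squarefree_exponent (\<sigma> - {p} - {q}))))"
      unfolding p by (simp add: edge_cochain_def Diff_insert2[symmetric] mult_ac)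
    also have "\<dots> = vertex_cochain \<sigma> p Z"
      using assms by (subst var_mult_squarefree) (auto simp: vertex_cochain_def p)
    finally show ?thesis using assms(3) p by (auto simp: vertex_cochain_def)
  next
    case q
    have "p \<in> Z" "Z - {p} = - {p, q}" using q assms by auto
    note single[OF this]
    also have "koszul_sign p Z * var p * ?E (- {p, q}) =
        koszul_sign p Z * (koszul_sign p UNIV * koszul_sign q (- {p})) *
          (var p * monomial (squarefree_exponent (\<sigma> - {q} - {p})))"
      unfolding q by (simp add: edge_cochain_def Diff_insert2[symmetric] insert_commute mult_ac)
    also have "koszul_sign p UNIV * koszul_sign q (- {p}) =
        - (koszul_sign q UNIV * koszul_sign p Z :: ('n, 'k) mpoly)"
      using koszul_sign_swap[of q UNIV p, where 'r = "('n, 'k) mpoly"] assms(3) 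
      by (simp add: q Compl_eq_Diff_UNIV)
    also have "var p * monomial (squarefree_exponent (\<sigma> - {q} - {p})) =
        (monomial (squarefree_exponent (\<sigma> - {q})) :: ('n, 'k) mpoly)"
      using assms by (intro var_mult_squarefree) auto
    finally show ?thesis using assms(3) q
      by (auto simp: vertex_cochain_def mult.commute)
  next
    case neither
    have "Z - {j} \<noteq> - {p, q}" if "j \<in> Z" for j
    proof
      assume "Z - {j} = - {p, q}"
      then have "Z = insert j (- {p, q})" "j \<in> {p, q}" using that by auto
      then show False using neither assms(3) by auto
    qed
    then have "koszul_d ?E Z = 0" by (auto simp: koszul_d_def edge_cochain_def intro!: sum.neutral)
    then show ?thesis using neither by (simp add: vertex_cochain_def)
  qed
qed



text \<open>
  Suppose that \<open>s\<close> and \<open>t\<close> are not adjacent. The path from \<open>s\<close> to \<open>t\<close> closes up over \<open>a\<close> to a cycle, and it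
  gives a cocycle of degree \<open>n - 2\<close> for the restriction of the complex to \<open>\<sigma> = {a, s, t} \<union> C\<close>. No
  triangle on these vertices contains the edge \<open>a s\<close>: its third vertex would be a neighbour of \<open>a\<close>, hence
  \<open>t\<close>, and also a neighbour of \<open>s\<close>. So this edge has coefficient \<open>0\<close> in every boundary, while it occurs
  exactly once in the cycle.
\<close>

lemma koszul_acyclic_chord:
  fixes \<U> :: "'n::{finite,linorder} set set"
  assumes up: "upward_closed \<U>"
    and ac: "\<And>B. koszul_acyclic (polys_on (localize B \<U>) :: ('n, 'k::field) mpoly set) (CARD('n) - 2)"
    and as: "adjacent \<U> a s" and at: "adjacent \<U> a t" and st: "s \<noteq> t"
    and C: "a \<notin> C" "\<And>x. x \<in> C \<Longrightarrow> \<not> adjacent \<U> a x"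
    and path: "(\<lambda>x y. adjacent \<U> x y \<and> x \<in> C \<union> {s, t} \<and> y \<in> C \<union> {s, t})\<^sup>*\<^sup>* s t"
  shows "adjacent \<U> s t"
proof (rule ccontr)
  assume nst: "\<not> adjacent \<U> s t"
  define \<sigma> where "\<sigma> = insert a (insert s (insert t C))"
  let ?J = "polys_on (localize (- \<sigma>) \<U>) :: ('n, 'k) mpoly set"
  have J: "is_ideal ?J" by (intro is_ideal_polys_on upward_closed_localize up)
  have ne: "a \<noteq> s" "a \<noteq> t" using as at by (auto simp: adjacent_def)
  have E: "edge_cochain \<sigma> p q Z \<in> ?J" if "adjacent \<U> p q" "p \<in> \<sigma>" "q \<in> \<sigma>" for p q Z
  proof (cases "Z = - {p, q}")
    case True
    have "- \<sigma> \<union> (\<sigma> - {p, q}) = - {p, q}" using that by auto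
    then have "monomial (squarefree_exponent (\<sigma> - {p, q})) \<in> ?J"
      using that by (simp add: monomial_in_polys_on localize_def adjacent_def)
    then show ?thesis using True by (auto simp: edge_cochain_def intro: ideal.subspace_scale[OF J])
  qed (simp add: edge_cochain_def ideal.subspace_0[OF J])
  have "\<exists>c. (\<forall>Z. c Z \<in> ?J) \<and> (\<forall>Z. koszul_d c Z = vertex_cochain \<sigma> s Z - vertex_cochain \<sigma> t Z) \<and>
    c (- {a, s}) = 0"
    using path
  proof (induction rule: rtranclp_induct)
    case base
    show ?case
      by (rule exI[of _ "\<lambda>_. 0"]) (simp add: koszul_d_def ideal.subspace_0[OF J])
  next
    case (step x y)
    then obtain c where c: "\<And>Z. c Z \<in> ?J"
        "\<And>Z. koszul_d c Z = vertex_cochain \<sigma> s Z - vertex_cochain \<sigma> x Z" "c (- {a, s}) = 0"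
      by blast
    have xy: "adjacent \<U> x y" "x \<in> \<sigma>" "y \<in> \<sigma>" "x \<noteq> y" "a \<noteq> x" "a \<noteq> y"
      using step(2) C(1) ne by (auto simp: \<sigma>_def adjacent_def)
    have "- {a, s} \<noteq> - {x, y}" using xy by auto
    then have "edge_cochain \<sigma> x y (- {a, s}) = (0 :: ('n, 'k) mpoly)"
      by (simp only: edge_cochain_def if_False)
    then show ?case
      using c xy E[OF xy(1-3)]
      by (intro exI[of _ "\<lambda>Z. c Z + edge_cochain \<sigma> x y Z"])
         (simp add: koszul_d_add koszul_d_edge_cochain ideal.subspace_add[OF J])
  qed
  then obtain c where c: "\<And>Z. c Z \<in> ?J"
      "\<And>Z. koszul_d c Z = vertex_cochain \<sigma> s Z - vertex_cochain \<sigma> t Z" "c (- {a, s}) = 0"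
    by blast
  \<comment> \<open>closing the path from \<open>s\<close> to \<open>t\<close> through \<open>a\<close>\<close>
  define g where "g Z = c Z + edge_cochain \<sigma> t a Z + edge_cochain \<sigma> a s Z" for Z
  have \<sigma>: "a \<in> \<sigma>" "s \<in> \<sigma>" "t \<in> \<sigma>" by (auto simp: \<sigma>_def)
  have "g Z \<in> ?J" for Z
    unfolding g_def using c(1) E[OF as] E[OF adjacent_sym[OF at]] \<sigma> by (intro ideal.subspace_add[OF J]) auto
  moreover have "koszul_d g Z = 0" for Z
    unfolding g_def koszul_d_add using \<sigma> ne by (simp add: c koszul_d_edge_cochain)
  ultimately obtain b where b: "\<And>Z. b Z \<in> ?J" "\<And>Z. card Z = CARD('n) - 2 \<Longrightarrow> g Z = koszul_d b Z"
    using koszul_acyclicE[OF ac, of g "- \<sigma>"] by auto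
  let ?m = "squarefree_exponent (\<sigma> - {a, s})"
  have "card (- {a, s}) = CARD('n) - 2"
    using ne card_Diff_subset[of "{a, s}" UNIV] unfolding Compl_eq_Diff_UNIV by simp
  then have "Poly_Mapping.lookup (g (- {a, s})) ?m = Poly_Mapping.lookup (koszul_d b (- {a, s})) ?m"
    using b(2) by simp
  also have "\<dots> = 0"
  proof (rule lookup_coboundary_zero[OF b(1)])
    fix j assume j: "j \<in> - {a, s} \<inter> (\<sigma> - {a, s})"
    then have *: "- \<sigma> \<union> (\<sigma> - {a, s} - {j}) = - {a, s, j}" by (auto simp: \<sigma>_def)
    have "- {a, j} \<notin> \<U> \<or> - {s, j} \<notin> \<U>"
      using j C(2)[of j] nst st ne by (auto simp: \<sigma>_def adjacent_def)
    then have "- {a, s, j} \<notin> \<U>"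
      using upward_closedD[OF up, of "- {a, s, j}" "- {a, j}"]
        upward_closedD[OF up, of "- {a, s, j}" "- {s, j}"] by auto
    then show "\<sigma> - {a, s} - {j} \<notin> localize (- \<sigma>) \<U>" by (simp add: localize_def *)
  qed
  finally have "Poly_Mapping.lookup (g (- {a, s})) ?m = 0" .
  moreover have "- {a, s} \<noteq> - {t, a}" using st ne by auto
  then have "edge_cochain \<sigma> t a (- {a, s}) = (0 :: ('n, 'k) mpoly)"
    by (simp only: edge_cochain_def if_False)
  then have "g (- {a, s}) = koszul_sign a UNIV * (koszul_sign s (- {a}) * monomial ?m)"
    unfolding g_def c(3) by (simp only: add_0 edge_cochain_def if_True refl mult.assoc)
  ultimately show False
    by (simp add: lookup_koszul_sign_mult lookup_monomial koszul_sign_nonzero)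
qed

section \<open>Interval partitions\<close>

inductive interval_partitionable :: "nat \<Rightarrow> 'n::finite set set \<Rightarrow> bool" for d where
  empty: "interval_partitionable d {}"
| insert: "interval_partitionable d \<F> \<Longrightarrow> A \<subseteq> B \<Longrightarrow> d \<le> card B \<Longrightarrow> \<F> \<inter> {A..B} = {} \<Longrightarrow>
    interval_partitionable d (\<F> \<union> {A..B})"

lemma interval_partitionable_interval:
  assumes "A \<subseteq> B" "d \<le> card B"
  shows "interval_partitionable d {A..B}"
  using interval_partitionable.insert[OF interval_partitionable.empty assms] by simp

lemma interval_partitionable_Un:
  assumes "interval_partitionable d \<G>" "interval_partitionable d \<F>" "\<F> \<inter> \<G> = {}"
  shows "interval_partitionable d (\<F> \<union> \<G>)"
  using assms
proof (induction rule: interval_partitionable.induct)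
  case empty
  then show ?case by simp
next
  case (insert \<G> A B)
  then have "interval_partitionable d ((\<F> \<union> \<G>) \<union> {A..B})"
    by (intro interval_partitionable.insert) auto
  then show ?case by (simp add: Un_assoc)
qed

lemma interval_partitionable_mono:
  assumes "interval_partitionable d \<F>" "c \<le> d"
  shows "interval_partitionable c \<F>"
  using assms
  by (induction rule: interval_partitionable.induct)
     (auto intro: interval_partitionable.intros order_trans)


section \<open>Stanley decompositions from interval partitions\<close>

lemma polys_on_Un:
  "polys_on (\<F> \<union> \<G>) = {f + g | f g. f \<in> polys_on \<F> \<and> g \<in> (polys_on \<G> :: ('n, 'k::field) mpoly set)}"
proof (intro subset_antisym subsetI)
  fix h :: "('n, 'k) mpoly" assume h: "h \<in> polys_on (\<F> \<union> \<G>)"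
  define f where "f = (\<Sum>t\<in>{t \<in> Poly_Mapping.keys h. Poly_Mapping.keys t \<in> \<F>}.
    Poly_Mapping.single t (Poly_Mapping.lookup h t))"
  have f: "Poly_Mapping.lookup f t = (if Poly_Mapping.keys t \<in> \<F> then Poly_Mapping.lookup h t else 0)" for t
    by (auto simp: f_def lookup_sum lookup_single when_def in_keys_iff)
  have "f \<in> polys_on \<F>" "h - f \<in> polys_on \<G>"
    using h by (auto simp: polys_on_iff f lookup_minus)
  then show "h \<in> {f + g | f g. f \<in> polys_on \<F> \<and> g \<in> polys_on \<G>}"
    by (intro CollectI exI[of _ f] exI[of _ "h - f"]) simp
qed (auto simp: polys_on_iff lookup_add)

text \<open>
  A monomial \<open>t\<close> lies in \<open>x\<^sup>A K[B]\<close> if and only if \<open>x\<^sup>A\<close> divides \<open>t\<close> and \<open>t\<close> involves only variables in \<open>B\<close>;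
  as \<open>x\<^sup>A\<close> is squarefree, this is a condition on the support of \<open>t\<close> alone.
\<close>

lemma mK_monomial:
  assumes "A \<subseteq> B"
  shows "mK (*) (monomial (squarefree_exponent A), B) = (polys_on {A..B} :: ('n::finite, 'k::field) mpoly set)"
proof (intro subset_antisym subsetI)
  let ?A = "squarefree_exponent A"
  fix g :: "('n, 'k) mpoly" assume "g \<in> mK (*) (monomial ?A, B)"
  then obtain f where f: "f \<in> subring_in B" "g = f * monomial ?A" by (auto simp: mK_def)
  show "g \<in> polys_on {A..B}"
    unfolding polys_on_def
  proof (intro CollectI ballI)
    fix t assume "t \<in> Poly_Mapping.keys g"
    then obtain a where "t = a + ?A" "a \<in> Poly_Mapping.keys f"
      using keys_mult[of f "monomial ?A"] by (auto simp: f monomial_def)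
    then show "Poly_Mapping.keys t \<in> {A..B}"
      using f(1) assms by (auto simp: keys_add_exponents subring_in_def)
  qed
next
  let ?A = "squarefree_exponent A"
  fix g :: "('n, 'k) mpoly" assume g: "g \<in> polys_on {A..B}"
  define f where "f = Poly_Mapping.map_key (\<lambda>t. ?A + t) g"
  have "inj (\<lambda>t. ?A + t)" by (auto intro: injI)
  then have f: "Poly_Mapping.lookup f t = Poly_Mapping.lookup g (?A + t)" for t
    by (simp add: f_def map_key.rep_eq)
  have "Poly_Mapping.lookup g t = Poly_Mapping.lookup (monomial ?A * f) t" for t
  proof (cases "\<exists>q. t = ?A + q")
    case True
    then show ?thesis by (auto simp: lookup_monomial_mult f)
  next
    case False
    have "\<not> A \<subseteq> Poly_Mapping.keys t"
    proof
      assume "A \<subseteq> Poly_Mapping.keys t"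
      then have "t = ?A + (t - ?A)"
        by (intro poly_mapping_eqI)
           (auto simp: lookup_add lookup_minus lookup_squarefree_exponent in_keys_iff subset_iff)
      then show False using False by blast
    qed
    then show ?thesis using g False by (auto simp: lookup_monomial_mult_zero polys_on_iff)
  qed
  then have "g = f * monomial ?A" by (simp add: poly_mapping_eqI mult.commute)
  moreover have "f \<in> subring_in B"
    unfolding subring_in_def
  proof (intro CollectI ballI)
    fix t assume "t \<in> Poly_Mapping.keys f"
    then have "?A + t \<in> Poly_Mapping.keys g" by (simp add: in_keys_iff f)
    then have "Poly_Mapping.keys (?A + t) \<in> {A..B}" using g unfolding polys_on_def by blast
    then show "Poly_Mapping.keys t \<subseteq> B" by (simp add: keys_add_exponents)
  qed
  ultimately show "g \<in> mK (*) (monomial ?A, B)" by (auto simp: mK_def)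
qed

lemma stanley_space_monomial:
  assumes "monomial t \<in> (M :: ('n, 'k::field) mpoly set)"
  shows "stanley_space (*) component M (monomial t, Z)"
proof -
  have "monomial t \<in> component (\<lambda>i. int (Poly_Mapping.lookup t i))"
    by (auto simp: component_def monomial_def split: if_splits)
  moreover have "free_over (*) (subring_in Z) (mK (*) (monomial t :: ('n, 'k) mpoly, Z))"
    unfolding free_over_def
  proof (intro exI[of _ "{monomial t}"] conjI allI impI)
    have 0: "0 \<in> (subring_in Z :: ('n, 'k) mpoly set)" by (simp add: subring_in_def)
    show "mK (*) (monomial t :: ('n, 'k) mpoly, Z) =
      {\<Sum>b\<in>F. c b * b | F c. finite F \<and> F \<subseteq> {monomial t} \<and> (\<forall>b\<in>F. c b \<in> subring_in Z)}"
    proof (intro subset_antisym subsetI)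
      fix g :: "('n, 'k) mpoly" assume "g \<in> mK (*) (monomial t, Z)"
      then obtain f where "f \<in> subring_in Z" "g = f * monomial t" by (auto simp: mK_def)
      then show "g \<in> {\<Sum>b\<in>F. c b * b | F c. finite F \<and> F \<subseteq> {monomial t} \<and> (\<forall>b\<in>F. c b \<in> subring_in Z)}"
        by (intro CollectI exI[of _ "{monomial t}"] exI[of _ "\<lambda>_. f"]) simp
    next
      fix g :: "('n, 'k) mpoly"
      assume "g \<in> {\<Sum>b\<in>F. c b * b | F c. finite F \<and> F \<subseteq> {monomial t} \<and> (\<forall>b\<in>F. c b \<in> subring_in Z)}"
      then obtain F c where g: "g = (\<Sum>b\<in>F. c b * b)" "F \<subseteq> {monomial t}" "\<forall>b\<in>F. c b \<in> subring_in Z" by blast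
      show "g \<in> mK (*) (monomial t, Z)"
      proof (cases "F = {}")
        case True
        then show ?thesis using g 0 by (auto simp: mK_def intro!: image_eqI[of _ _ 0])
      next
        case False
        then have "F = {monomial t}" using g(2) by auto
        then show ?thesis using g by (auto simp: mK_def)
      qed
    qed
  next
    fix F and c :: "('n, 'k) mpoly \<Rightarrow> ('n, 'k) mpoly"
    assume *: "finite F \<and> F \<subseteq> {monomial t} \<and> (\<forall>b\<in>F. c b \<in> subring_in Z) \<and> (\<Sum>b\<in>F. c b * b) = 0"
    show "\<forall>b\<in>F. c b = 0"
    proof
      fix b assume "b \<in> F"
      then have F: "F = {monomial t}" "b = monomial t" using * by auto
      then have "monomial t * c b = 0" using * by (simp add: mult.commute)
      then have "Poly_Mapping.lookup (c b) s = 0" for s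
        by (metis lookup_monomial_mult lookup_zero)
      then show "c b = 0" by (intro poly_mapping_eqI) simp
    qed
  qed
  ultimately show ?thesis using assms by (auto simp: stanley_space_def)
qed

lemma direct_sum_decomp_Suc:
  assumes dec: "direct_sum_decomp M r V"
    and ind: "\<And>x y. x \<in> M \<Longrightarrow> y \<in> N \<Longrightarrow> x + y = 0 \<Longrightarrow> y = 0"
    and W: "\<And>i. i < r \<Longrightarrow> W i = V i" "W r = N"
  shows "direct_sum_decomp {x + y | x y. x \<in> M \<and> y \<in> N} (Suc r) W"
  unfolding direct_sum_decomp_def
proof (intro conjI allI impI)
  have M: "M = {\<Sum>i<r. v i | v. \<forall>i<r. v i \<in> V i}"
    using dec by (simp add: direct_sum_decomp_def)
  show "{x + y | x y. x \<in> M \<and> y \<in> N} = {\<Sum>i<Suc r. v i | v. \<forall>i<Suc r. v i \<in> W i}"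
  proof (intro subset_antisym subsetI)
    fix z assume "z \<in> {x + y | x y. x \<in> M \<and> y \<in> N}"
    then obtain v y where v: "\<forall>i<r. v i \<in> V i" "y \<in> N" "z = (\<Sum>i<r. v i) + y"
      unfolding M by blast
    have "(\<Sum>i<Suc r. (v(r := y)) i) = (\<Sum>i<r. v i) + y" by simp
    then show "z \<in> {\<Sum>i<Suc r. v i | v. \<forall>i<Suc r. v i \<in> W i}"
      using v W by (intro CollectI exI[of _ "v(r := y)"]) (auto simp: less_Suc_eq)
  next
    fix z assume "z \<in> {\<Sum>i<Suc r. v i | v. \<forall>i<Suc r. v i \<in> W i}"
    then obtain v where v: "\<forall>i<Suc r. v i \<in> W i" "z = (\<Sum>i<r. v i) + v r" by auto
    then have "\<forall>i<r. v i \<in> V i" "v r \<in> N" using W by (metis less_SucI, metis lessI)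
    then have "(\<Sum>i<r. v i) \<in> M" "v r \<in> N" unfolding M by blast+
    then show "z \<in> {x + y | x y. x \<in> M \<and> y \<in> N}" using v(2) by blast
  qed
  fix v i assume v: "(\<forall>i<Suc r. v i \<in> W i) \<and> (\<Sum>i<Suc r. v i) = 0" and i: "i < Suc r"
  have vV: "\<forall>i<r. v i \<in> V i" "v r \<in> N" using v W by (metis less_SucI, metis lessI)
  then have "(\<Sum>i<r. v i) \<in> M" unfolding M by blast
  then have r: "v r = 0" using ind[OF _ vV(2)] v by simp
  then have "(\<Sum>i<r. v i) = 0" using v by simp
  then have "\<forall>i<r. v i = 0" using dec vV(1) by (simp add: direct_sum_decomp_def)
  then show "v i = 0" using r i by (auto simp: less_Suc_eq)
qed

lemma interval_partitionable_decomposition: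
  fixes \<F> :: "'n::finite set set"
  assumes "interval_partitionable d \<F>"
  shows "\<exists>D :: (('n, 'k::field) mpoly \<times> 'n set) list.
    direct_sum_decomp (polys_on \<F>) (length D) (\<lambda>i. mK (*) (D ! i)) \<and>
    (\<forall>(m, Z)\<in>set D. (\<exists>A\<in>\<F>. m = monomial (squarefree_exponent A)) \<and> d \<le> card Z)"
  using assms
proof (induction rule: interval_partitionable.induct)
  case empty
  show ?case
    by (rule exI[of _ "[]"]) (auto simp: direct_sum_decomp_def polys_on_empty)
next
  case (insert \<F> A B)
  then obtain D :: "(('n, 'k) mpoly \<times> 'n set) list" where
    D: "direct_sum_decomp (polys_on \<F>) (length D) (\<lambda>i. mK (*) (D ! i))"
      "\<And>m Z. (m, Z) \<in> set D \<Longrightarrow> (\<exists>A\<in>\<F>. m = monomial (squarefree_exponent A)) \<and> d \<le> card Z"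
    by blast
  let ?D = "D @ [(monomial (squarefree_exponent A), B)]"
  have "y = 0" if "x \<in> polys_on \<F>" "y \<in> polys_on {A..B}" "x + y = 0" for x y :: "('n, 'k) mpoly"
  proof (rule poly_mapping_eqI)
    fix t
    have "Poly_Mapping.lookup x t + Poly_Mapping.lookup y t = 0"
      using that(3) by (metis lookup_add lookup_zero)
    then show "Poly_Mapping.lookup y t = Poly_Mapping.lookup 0 t"
      using that(1,2) insert(4) by (cases "Poly_Mapping.keys t \<in> \<F>") (auto simp: polys_on_iff disjoint_iff)
  qed
  then have "direct_sum_decomp (polys_on (\<F> \<union> {A..B})) (length ?D) (\<lambda>i. mK (*) (?D ! i))"
    using direct_sum_decomp_Suc[OF D(1), of "polys_on {A..B}" "\<lambda>i. mK (*) (?D ! i)"] insert(2)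
    by (auto simp: nth_append mK_monomial polys_on_Un)
  moreover have "A \<in> {A..B}" using insert(2) by simp
  ultimately show ?case
    using D(2) insert(3) by (intro exI[of _ ?D]) (auto; blast)
qed

lemma sdepth_ge_interval_partitionable:
  assumes "interval_partitionable d \<U>"
  shows "enat d \<le> sdepth (*) component (polys_on \<U> :: ('n::finite, 'k::field) mpoly set)"
proof -
  obtain D :: "(('n, 'k) mpoly \<times> 'n set) list" where
    D: "direct_sum_decomp (polys_on \<U>) (length D) (\<lambda>i. mK (*) (D ! i))"
      "\<And>m Z. (m, Z) \<in> set D \<Longrightarrow> (\<exists>A\<in>\<U>. m = monomial (squarefree_exponent A)) \<and> d \<le> card Z"
    using interval_partitionable_decomposition[OF assms, where 'k = 'k] by blast
  have "stanley_space (*) component (polys_on \<U>) mZ" if "mZ \<in> set D" for mZ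
  proof -
    obtain A where A: "A \<in> \<U>" "mZ = (monomial (squarefree_exponent A), snd mZ)"
      using D(2)[of "fst mZ" "snd mZ"] \<open>mZ \<in> set D\<close> by (cases mZ) auto
    then have "monomial (squarefree_exponent A) \<in> (polys_on \<U> :: ('n, 'k) mpoly set)"
      by (simp add: monomial_in_polys_on)
    from stanley_space_monomial[OF this, of "snd mZ"] show ?thesis using A(2) by simp
  qed
  then have "stanley_decomposition (*) component (polys_on \<U>) D"
    using D(1) by (auto simp: stanley_decomposition_def)
  then have "sdepth_decomp D \<le> Sup {sdepth_decomp D | D. stanley_decomposition (*) component (polys_on \<U> :: ('n, 'k) mpoly set) D}"
    by (intro Sup_upper) blast
  moreover have "enat d \<le> sdepth_decomp D"
    unfolding sdepth_decomp_def using D(2) by (intro INF_greatest) auto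
  ultimately have "enat d \<le> Sup {sdepth_decomp D | D. stanley_decomposition (*) component (polys_on \<U> :: ('n, 'k) mpoly set) D}"
    by (rule order_trans[rotated])
  then show ?thesis by (simp add: sdepth_def)
qed

section \<open>Simplicial vertices of chordal graphs\<close>

text \<open>
  Chordality in the form supplied by the Koszul complex: neighbours of \<open>a\<close> joined by a path whose interior
  avoids \<open>a\<close> and its neighbours are adjacent. For \<open>s\<close> and \<open>t\<close> not adjacent, a shortest such path would
  form an induced cycle of length at least four together with \<open>a\<close>.
\<close>

locale chordal_graph =
  fixes adj :: "'a \<Rightarrow> 'a \<Rightarrow> bool"
  assumes sym: "adj x y \<Longrightarrow> adj y x"
    and irrefl: "\<not> adj x x"
    and chord: "adj a s \<Longrightarrow> adj a t \<Longrightarrow> s \<noteq> t \<Longrightarrow> a \<notin> C \<Longrightarrow> (\<And>x. x \<in> C \<Longrightarrow> \<not> adj a x) \<Longrightarrow>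
      (\<lambda>x y. adj x y \<and> x \<in> C \<union> {s, t} \<and> y \<in> C \<union> {s, t})\<^sup>*\<^sup>* s t \<Longrightarrow> adj s t"
begin

definition simplicial :: "'a set \<Rightarrow> 'a \<Rightarrow> bool" where
  "simplicial X w \<longleftrightarrow> w \<in> X \<and> (\<forall>x\<in>X. \<forall>y\<in>X. adj w x \<longrightarrow> adj w y \<longrightarrow> x \<noteq> y \<longrightarrow> adj x y)"

text \<open>
  Dirac's argument. Let \<open>C\<close> be the connected component of \<open>b\<close> after removing \<open>a\<close> and its neighbours, and
  let \<open>S\<close> be the set of neighbours of \<open>a\<close> that have a neighbour in \<open>C\<close>. Chordality makes \<open>S\<close> a clique.
  The smaller set \<open>Y = C \<union> S\<close> contains all neighbours of points of \<open>C\<close>, so a vertex of \<open>C\<close> that is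
  simplicial in \<open>Y\<close> is simplicial in \<open>X\<close>, and it is not adjacent to \<open>a\<close>. If \<open>Y\<close> is a clique, \<open>b\<close> is such
  a vertex. Otherwise apply induction to a nonadjacent pair in \<open>Y\<close>. If some \<open>s \<in> S\<close> belongs to such a
  pair, the vertex that is found is not adjacent to \<open>s\<close> and hence lies outside the clique \<open>S\<close>; if not, no
  vertex in \<open>S\<close> has a nonneighbour in \<open>Y\<close>, so again the vertex that is found lies in \<open>C\<close>.
\<close>

lemma simplicial_nonadjacent:
  assumes "finite X" "a \<in> X" "b \<in> X" "a \<noteq> b" "\<not> adj a b"
  shows "\<exists>w. simplicial X w \<and> w \<noteq> a \<and> \<not> adj a w"
  using assms
proof (induction X arbitrary: a b rule: finite_psubset_induct)
  case (psubset X)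
  define R where "R x y \<longleftrightarrow> adj x y \<and> x \<in> X \<and> y \<in> X \<and> x \<noteq> a \<and> y \<noteq> a \<and> \<not> adj a x \<and> \<not> adj a y" for x y
  define C where "C = {x. R\<^sup>*\<^sup>* b x}"
  define S where "S = {x \<in> X. adj a x \<and> (\<exists>c\<in>C. adj c x)}"
  define Y where "Y = C \<union> S"
  have b: "b \<in> C" by (simp add: C_def)
  have C: "x \<in> X \<and> x \<noteq> a \<and> \<not> adj a x" if "x \<in> C" for x
  proof -
    have "R\<^sup>*\<^sup>* b x" using that by (simp add: C_def)
    then show ?thesis by (induction rule: rtranclp_induct) (use psubset.prems in \<open>auto simp: R_def\<close>)
  qed
  have S_clique: "adj s t" if st: "s \<in> S" "t \<in> S" "s \<noteq> t" for s t
  proof (rule chord[of a s t C])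
    let ?P = "\<lambda>x y. adj x y \<and> x \<in> C \<union> {s, t} \<and> y \<in> C \<union> {s, t}"
    have reach: "?P\<^sup>*\<^sup>* b c" if "c \<in> C" for c
    proof -
      have "R\<^sup>*\<^sup>* b c" using that by (simp add: C_def)
      then show ?thesis
      proof (induction rule: rtranclp_induct)
        case (step x y)
        have "R\<^sup>*\<^sup>* b y" using step(1,2) by (rule rtranclp.rtrancl_into_rtrancl)
        then have "?P x y" using step(1,2) by (simp add: R_def C_def)
        with step.IH show ?case by (rule rtranclp.rtrancl_into_rtrancl)
      qed simp
    qed
    have "symp ?P" by (rule sympI) (auto dest: sym)
    then have reach': "?P\<^sup>*\<^sup>* c b" if "c \<in> C" for c
      using sympD[OF symp_rtranclp reach[OF that]] by blast
    obtain c c' where c: "c \<in> C" "adj c s" "c' \<in> C" "adj c' t" using st by (auto simp: S_def)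
    have "?P s c" using c sym by auto
    then have "?P\<^sup>*\<^sup>* s b" using reach'[OF c(1)] by (rule converse_rtranclp_into_rtranclp)
    also have "?P\<^sup>*\<^sup>* b c'" by (rule reach[OF c(3)])
    also have "?P c' t" using c by auto
    finally show "?P\<^sup>*\<^sup>* s t" .
  qed (use st C in \<open>auto simp: S_def\<close>)
  have Y: "Y \<subset> X" using psubset.prems C irrefl by (auto simp: Y_def S_def)
  have nbrs: "x \<in> Y" if "w \<in> C" "x \<in> X" "adj w x" for w x
  proof (cases "adj a x")
    case False
    have "R w x" using that C[OF that(1)] False sym[of w x] by (auto simp: R_def)
    moreover have "R\<^sup>*\<^sup>* b w" using that(1) by (simp add: C_def)
    ultimately have "R\<^sup>*\<^sup>* b x" by (rule rtranclp.rtrancl_into_rtrancl[rotated])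
    then show ?thesis by (simp add: Y_def C_def)
  qed (use that in \<open>auto simp: Y_def S_def\<close>)
  have "\<exists>w\<in>C. simplicial Y w"
  proof (cases "\<exists>s\<in>S. \<exists>y\<in>Y. s \<noteq> y \<and> \<not> adj s y")
    case True
    then obtain s y where s: "s \<in> S" "y \<in> Y" "s \<noteq> y" "\<not> adj s y" by blast
    then obtain w where "simplicial Y w" "w \<noteq> s" "\<not> adj s w"
      using psubset.IH[OF Y, of s y] by (auto simp: Y_def)
    then show ?thesis using S_clique[OF s(1)] by (auto simp: simplicial_def Y_def)
  next
    case S: False
    show ?thesis
    proof (cases "\<exists>p\<in>C. \<exists>q\<in>Y. p \<noteq> q \<and> \<not> adj p q")
      case True
      then obtain p q where p: "p \<in> C" "q \<in> Y" "p \<noteq> q" "\<not> adj p q" by blast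
      then obtain w where w: "simplicial Y w" "w \<noteq> p" "\<not> adj p w"
        using psubset.IH[OF Y, of p q] by (auto simp: Y_def)
      then have "w \<notin> S" using S p(1) sym by (auto simp: Y_def)
      then show ?thesis using w by (auto simp: simplicial_def Y_def)
    next
      case False
      then have "simplicial Y b" using S b by (auto simp: simplicial_def Y_def)
      then show ?thesis using b by blast
    qed
  qed
  then obtain w where w: "w \<in> C" "simplicial Y w" by blast
  then have "simplicial X w" using nbrs[OF w(1)] C by (auto simp: simplicial_def)
  then show ?case using C[OF w(1)] by blast
qed

lemma ex_simplicial:
  assumes "finite X" "X \<noteq> {}"
  shows "\<exists>w. simplicial X w"
proof (cases "\<exists>a\<in>X. \<exists>b\<in>X. a \<noteq> b \<and> \<not> adj a b")
  case True
  then show ?thesis using simplicial_nonadjacent[OF assms(1)] by blast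
next
  case False
  obtain w where "w \<in> X" using assms(2) by blast
  then have "simplicial X w" using False by (auto simp: simplicial_def)
  then show ?thesis by blast
qed

end

section \<open>Ideals of large depth\<close>

text \<open>
  Minimal nonfaces have at most \<open>k\<close> vertices. Indeed \<open>koszul_acyclic_insert\<close> for \<open>A = - G\<close> needs acyclicity
  in degree \<open>n - card G + 1\<close>, which is at most \<open>n - k\<close> as soon as \<open>G\<close> has more than \<open>k\<close> elements.
\<close>

lemma koszul_acyclic_flag:
  fixes \<U> :: "'n::{finite,linorder} set set"
  assumes up: "upward_closed \<U>"
    and ac: "\<And>i. i \<le> CARD('n) - k \<Longrightarrow> koszul_acyclic (polys_on \<U> :: ('n, 'k::field) mpoly set) i"
    and small: "\<And>G. G \<subseteq> F \<Longrightarrow> card G \<le> k \<Longrightarrow> - G \<in> \<U>"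
  shows "- F \<in> \<U>"
proof -
  have "- G \<in> \<U>" if "G \<subseteq> F" for G
    using finite[of G] that
  proof (induction rule: finite_psubset_induct)
    case (psubset G)
    show ?case
    proof (cases "card G \<le> k")
      case False
      show ?thesis
      proof (rule ccontr)
        assume G: "- G \<notin> \<U>"
        have "card (- G) = CARD('n) - card G"
          by (simp add: Compl_eq_Diff_UNIV card_Diff_subset)
        moreover have "card G \<le> CARD('n)" by (rule card_mono) auto
        ultimately have "Suc (card (- G)) \<le> CARD('n) - k" using False by simp
        then have ac': "koszul_acyclic (polys_on (localize (- G) \<U>) :: ('n, 'k) mpoly set) (Suc (card (- G)))"
          by (intro koszul_acyclic_localize up ac)
        have "- G \<noteq> UNIV" using False by (cases "G = {}") auto
        then obtain j where j: "j \<in> G" "insert j (- G) \<notin> \<U>"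
          using koszul_acyclic_insert[OF ac' up G] by blast
        have "insert j (- G) = - (G - {j})" by auto
        moreover have "- (G - {j}) \<in> \<U>" using psubset j by (intro psubset.IH) auto
        ultimately show False using j by simp
      qed
    qed (use psubset small in blast)
  qed
  then show ?thesis by blast
qed

text \<open>
  Elimination of simplicial vertices. If \<open>w\<close> is a simplicial vertex of \<open>X\<close> and \<open>F\<close> consists of \<open>w\<close> and its
  neighbours in \<open>X\<close>, then the faces in \<open>X\<close> that contain \<open>w\<close> are the sets between \<open>{w}\<close> and \<open>F\<close>. Their
  complements form the interval \<open>[- F, - {w}]\<close>, whose upper end has \<open>n - 1\<close> elements. In the end only
  the empty face remains, with complement the set of all variables.
\<close>

lemma interval_partitionable_chordal:
  fixes \<U> :: "'n::finite set set"
  assumes up: "upward_closed \<U>"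
    and flag: "\<And>F. (\<And>G. G \<subseteq> F \<Longrightarrow> card G \<le> 2 \<Longrightarrow> - G \<in> \<U>) \<Longrightarrow> - F \<in> \<U>"
    and "chordal_graph (adjacent \<U>)" and "\<U> \<noteq> {}"
  shows "interval_partitionable (CARD('n) - 1) \<U>"
proof -
  interpret chordal_graph "adjacent \<U>" by fact
  have UNIV: "UNIV \<in> \<U>" using assms(4) upward_closedD[OF up _ subset_UNIV] by blast
  have "X \<subseteq> {v. - {v} \<in> \<U>} \<Longrightarrow> interval_partitionable (CARD('n) - 1) {Y \<in> \<U>. - Y \<subseteq> X}" for X
    using finite[of X]
  proof (induction X rule: finite_psubset_induct)
    case (psubset X)
    show ?case
    proof (cases "X = {}")
      case True
      then have "{Y \<in> \<U>. - Y \<subseteq> X} = {UNIV..UNIV}" using UNIV by auto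
      then show ?thesis using interval_partitionable_interval[of UNIV "UNIV :: 'n set"] by simp
    next
      case False
      then obtain w where w: "simplicial X w" using ex_simplicial[of X] by auto
      define F where "F = insert w {x \<in> X. adjacent \<U> w x}"
      have wX: "w \<in> X" using w by (simp add: simplicial_def)
      have clique: "adjacent \<U> x y" if "x \<in> F" "y \<in> F" "x \<noteq> y" for x y
        using that w adjacent_sym by (auto simp: F_def simplicial_def)
      have F: "- F \<in> \<U>"
      proof (rule flag)
        fix G assume G: "G \<subseteq> F" "card G \<le> 2"
        then consider "card G = 0" | "card G = 1" | "card G = 2" by linarith
        then show "- G \<in> \<U>"
        proof cases
          case 1
          then show ?thesis using UNIV by simp
        next
          case 2
          then obtain x where "G = {x}" by (rule card_1_singletonE)
          then show ?thesis using G psubset.prems wX by (auto simp: F_def)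
        next
          case 3
          then obtain x y where "G = {x, y}" "x \<noteq> y" by (auto simp: card_2_iff)
          then show ?thesis using G clique[of x y] by (auto simp: adjacent_def)
        qed
      qed
      have split: "{Y \<in> \<U>. - Y \<subseteq> X} = {Y \<in> \<U>. - Y \<subseteq> X - {w}} \<union> {- F..- {w}}"
      proof (intro subset_antisym subsetI)
        fix Y assume Y: "Y \<in> {Y \<in> \<U>. - Y \<subseteq> X}"
        show "Y \<in> {Y \<in> \<U>. - Y \<subseteq> X - {w}} \<union> {- F..- {w}}"
        proof (cases "w \<in> Y")
          case False
          have "x \<in> F" if "x \<notin> Y" for x
          proof -
            have "- {w, x} \<in> \<U>" using upward_closedD[OF up, of Y "- {w, x}"] Y that False by auto
            then show ?thesis using that Y by (auto simp: F_def adjacent_def)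
          qed
          then show ?thesis using False by auto
        qed (use Y in auto)
      next
        fix Y assume "Y \<in> {Y \<in> \<U>. - Y \<subseteq> X - {w}} \<union> {- F..- {w}}"
        then show "Y \<in> {Y \<in> \<U>. - Y \<subseteq> X}"
          using upward_closedD[OF up F, of Y] wX by (auto simp: F_def)
      qed
      have "interval_partitionable (CARD('n) - 1) {Y \<in> \<U>. - Y \<subseteq> X - {w}}"
        using wX psubset.prems by (intro psubset.IH) auto
      moreover have "interval_partitionable (CARD('n) - 1) {- F..- {w}}"
        by (rule interval_partitionable_interval) (auto simp: F_def Compl_eq_Diff_UNIV card_Diff_subset)
      ultimately show ?thesis
        unfolding split by (intro interval_partitionable_Un) auto
    qed
  qed
  from this[of "{v. - {v} \<in> \<U>}"]
  have "interval_partitionable (CARD('n) - 1) {Y \<in> \<U>. - Y \<subseteq> {v. - {v} \<in> \<U>}}" by simp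
  also have "- {v} \<in> \<U>" if "Y \<in> \<U>" "v \<notin> Y" for Y v
    using upward_closedD[OF up, of Y "- {v}"] that by auto
  then have "- Y \<subseteq> {v. - {v} \<in> \<U>}" if "Y \<in> \<U>" for Y
    using that by auto
  then have "{Y \<in> \<U>. - Y \<subseteq> {v. - {v} \<in> \<U>}} = \<U>" by blast
  finally show ?thesis .
qed

lemma interval_partitionable_if_acyclic_minus_1:
  fixes \<U> :: "'n::{finite,linorder} set set"
  assumes up: "upward_closed \<U>" and "\<U> \<noteq> {}"
    and ac: "\<And>i. i \<le> CARD('n) - 2 \<Longrightarrow> koszul_acyclic (polys_on \<U> :: ('n, 'k::field) mpoly set) i"
  shows "interval_partitionable (CARD('n) - 1) \<U>"
proof (rule interval_partitionable_chordal[OF up _ _ assms(2)])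
  show "- F \<in> \<U>" if "\<And>G. G \<subseteq> F \<Longrightarrow> card G \<le> 2 \<Longrightarrow> - G \<in> \<U>" for F
    using koszul_acyclic_flag[OF up ac that] .
  show "chordal_graph (adjacent \<U>)"
  proof
    show "adjacent \<U> s t" if "adjacent \<U> a s" "adjacent \<U> a t" "s \<noteq> t" "a \<notin> C"
      "\<And>x. x \<in> C \<Longrightarrow> \<not> adjacent \<U> a x"
      "(\<lambda>x y. adjacent \<U> x y \<and> x \<in> C \<union> {s, t} \<and> y \<in> C \<union> {s, t})\<^sup>*\<^sup>* s t" for a s t C
      by (rule koszul_acyclic_chord[OF up koszul_acyclic_localize[OF up ac[OF order_refl]] that])
  qed (auto simp: adjacent_def insert_commute)
qed

lemma interval_partitionable_if_acyclic:
  fixes \<U> :: "'n::{finite,linorder} set set"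
  assumes up: "upward_closed \<U>" and "\<U> \<noteq> {}"
    and ac: "\<And>i. i \<le> CARD('n) - 1 \<Longrightarrow> koszul_acyclic (polys_on \<U> :: ('n, 'k::field) mpoly set) i"
  shows "interval_partitionable CARD('n) \<U>"
proof -
  define V where "V = {v. - {v} \<in> \<U>}"
  have UNIV: "UNIV \<in> \<U>" using assms(2) upward_closedD[OF up _ subset_UNIV] by blast
  have V: "- V \<in> \<U>"
  proof (rule koszul_acyclic_flag[OF up ac])
    fix G assume G: "G \<subseteq> V" "card G \<le> 1"
    then consider "card G = 0" | "card G = 1" by linarith
    then show "- G \<in> \<U>"
    proof cases
      case 2
      then obtain x where "G = {x}" by (rule card_1_singletonE)
      then show ?thesis using G by (auto simp: V_def)
    qed (use UNIV in simp)
  qed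
  have "- {v} \<in> \<U>" if "Y \<in> \<U>" "v \<notin> Y" for Y v
    using upward_closedD[OF up, of Y "- {v}"] that by auto
  then have "- V \<subseteq> Y" if "Y \<in> \<U>" for Y
    using that by (auto simp: V_def)
  moreover have "Y \<in> \<U>" if "- V \<subseteq> Y" for Y
    using upward_closedD[OF up V that] .
  ultimately have "\<U> = {- V..UNIV}" by (intro subset_antisym subsetI) (simp_all del: Compl_subset_Compl_iff)
  then show ?thesis using interval_partitionable_interval[of "- V" UNIV "CARD('n)"] by simp
qed

section \<open>Upward closed families on five elements\<close>

lemma interval_partitionable_large:
  assumes "\<And>A. A \<in> \<F> \<Longrightarrow> d \<le> card A"
  shows "interval_partitionable d \<F>"
  using finite[of \<F>] assms
proof (induction \<F> rule: finite_induct)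
  case (insert A \<F>)
  have "interval_partitionable d (\<F> \<union> {A..A})"
    using insert by (intro interval_partitionable_Un interval_partitionable_interval) auto
  then show ?case by simp
qed (rule interval_partitionable.empty)

lemma interval_partitionable_edge:
  assumes "upward_closed \<U>" "a \<notin> A" "d \<le> Suc (card A)"
  shows "interval_partitionable d (\<U> \<inter> {A, insert a A})"
proof (cases "A \<in> \<U>")
  case True
  then have "insert a A \<in> \<U>" using assms(1) upward_closedD[of \<U> A "insert a A"] by blast
  then have "\<U> \<inter> {A, insert a A} = {A..insert a A}" using True by auto
  then show ?thesis using assms by (auto intro!: interval_partitionable_interval)
next
  case False
  then show ?thesis using assms by (intro interval_partitionable_large) auto
qed

definition block :: "'n \<Rightarrow> 'n \<Rightarrow> 'n \<Rightarrow> 'n \<Rightarrow> 'n set set" where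
  "block a b c e = {{a}, {a, b}, {a, c}, {a, b, c}, {a, c, e}}"

text \<open>
  If \<open>{a} \<in> \<U>\<close>, then \<open>\<U>\<close> contains the whole block, which is the interval \<open>[{a}, {a, b, c}]\<close> together with
  \<open>{a, c, e}\<close>. Otherwise the two pairs \<open>{a, b} \<subseteq> {a, b, c}\<close> and \<open>{a, c} \<subseteq> {a, c, e}\<close> can be treated
  separately, and the part of each that lies in \<open>\<U>\<close> is empty or an interval.
\<close>

lemma interval_partitionable_block:
  fixes \<U> :: "'n::finite set set"
  assumes up: "upward_closed \<U>" and dist: "distinct [a, b, c, e]"
  shows "interval_partitionable 3 (\<U> \<inter> block a b c e)"
proof (cases "{a} \<in> \<U>")
  case True
  have "block a b c e \<subseteq> \<U>"
    using upward_closedD[OF up True] by (auto simp: block_def)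
  moreover have "block a b c e = {{a}..{a, b, c}} \<union> {{a, c, e}}"
    by (auto simp: block_def)
  moreover have "interval_partitionable 3 ({{a}..{a, b, c}} \<union> {{a, c, e}})"
    using dist by (intro interval_partitionable_Un interval_partitionable_interval interval_partitionable_large) auto
  ultimately show ?thesis by (simp add: Int_absorb1)
next
  case False
  then have "\<U> \<inter> block a b c e = (\<U> \<inter> {{a, b}, insert c {a, b}}) \<union> (\<U> \<inter> {{a, c}, insert e {a, c}})"
    by (auto simp: block_def insert_commute)
  moreover have "interval_partitionable 3 \<dots>"
    using dist
    by (intro interval_partitionable_Un interval_partitionable_edge up) (auto simp: set_eq_iff)
  ultimately show ?thesis by simp
qed

lemma UNIV_5: "UNIV = {0, 1, 2, 3, 4 :: 5}"
proof -
  have "card {0, 1, 2, 3, 4 :: 5} = CARD(5)" by simp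
  then show ?thesis by (metis card_subset_eq finite subset_UNIV)
qed

text \<open>
  The blocks are the translates of the one starting at \<open>0\<close>, with \<open>b = a + 1\<close>, \<open>c = a + 3\<close>, \<open>e = a + 4\<close> modulo
  \<open>5\<close>: the differences \<open>1\<close> and \<open>3\<close> account for each pair once, and the triples \<open>{a, a + 1, a + 3}\<close> and
  \<open>{a, a + 3, a + 4}\<close> represent the two cyclic types of triples.
\<close>

lemma blocks_cover:
  "Y = {} \<or> 4 \<le> card Y \<or> Y \<in> block 0 1 3 4 \<union> block 1 2 4 0 \<union> block 2 3 0 1 \<union> block 3 4 1 2 \<union> block 4 0 2 (3 :: 5)"
proof -
  have "\<forall>Y \<in> Pow {0, 1, 2, 3, 4 :: 5}. Y = {} \<or> 4 \<le> card Y \<or>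
      Y \<in> block 0 1 3 4 \<union> block 1 2 4 0 \<union> block 2 3 0 1 \<union> block 3 4 1 2 \<union> block 4 0 2 3"
    by (simp add: Pow_insert image_Un ball_Un block_def insert_commute)
  then show ?thesis by (metis UNIV_5 Pow_UNIV UNIV_I)
qed

lemma set_5_eq_iff:
  fixes A B :: "5 set"
  shows "A = B \<longleftrightarrow> (0 \<in> A \<longleftrightarrow> 0 \<in> B) \<and> (1 \<in> A \<longleftrightarrow> 1 \<in> B) \<and> (2 \<in> A \<longleftrightarrow> 2 \<in> B) \<and>
    (3 \<in> A \<longleftrightarrow> 3 \<in> B) \<and> (4 \<in> A \<longleftrightarrow> 4 \<in> B)"
proof -
  have "A = B \<longleftrightarrow> (\<forall>x\<in>UNIV. x \<in> A \<longleftrightarrow> x \<in> B)" by auto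
  then show ?thesis unfolding UNIV_5 by simp
qed

lemma blocks_disjoint:
  "block (0 :: 5) 1 3 4 \<inter> block 1 2 4 0 = {}" "block (0 :: 5) 1 3 4 \<inter> block 2 3 0 1 = {}"
  "block (0 :: 5) 1 3 4 \<inter> block 3 4 1 2 = {}" "block (0 :: 5) 1 3 4 \<inter> block 4 0 2 3 = {}"
  "block (1 :: 5) 2 4 0 \<inter> block 2 3 0 1 = {}" "block (1 :: 5) 2 4 0 \<inter> block 3 4 1 2 = {}"
  "block (1 :: 5) 2 4 0 \<inter> block 4 0 2 3 = {}" "block (2 :: 5) 3 0 1 \<inter> block 3 4 1 2 = {}"
  "block (2 :: 5) 3 0 1 \<inter> block 4 0 2 3 = {}" "block (3 :: 5) 4 1 2 \<inter> block 4 0 2 3 = {}"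
  by (simp_all add: block_def set_5_eq_iff)

lemma card_block:
  assumes "A \<in> block a b c e"
  shows "card A \<le> 3"
  using assms by (auto simp: block_def card_insert_if)

lemma interval_partitionable_3:
  fixes \<U> :: "5 set set"
  assumes up: "upward_closed \<U>"
  shows "interval_partitionable 3 \<U>"
proof (cases "{} \<in> \<U>")
  case True
  then have "\<U> = {{}..UNIV}" using upward_closedD[OF up True] by auto
  then show ?thesis using interval_partitionable_interval[of "{} :: 5 set" UNIV 3] by simp
next
  case False
  let ?L = "{Y. 4 \<le> card Y}"
  let ?R = "\<U> \<inter> block 0 1 3 4 \<union> \<U> \<inter> block 1 2 4 0 \<union> \<U> \<inter> block 2 3 0 1 \<union> \<U> \<inter> block 3 4 1 2 \<union>
    \<U> \<inter> block 4 0 2 3 \<union> \<U> \<inter> ?L"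
  have "Y \<in> ?R" if "Y \<in> \<U>" for Y
  proof -
    have "Y \<noteq> {}" using that False by blast
    then show ?thesis using blocks_cover[of Y] that by (simp only: Un_iff Int_iff mem_Collect_eq) blast
  qed
  then have "\<U> = ?R" by blast
  have restrict: "\<U> \<inter> \<F> \<inter> (\<U> \<inter> \<G>) = \<U> \<inter> (\<F> \<inter> \<G>)" for \<F> \<G>
    by blast
  have "interval_partitionable 3 ?R"
  proof (intro interval_partitionable_Un interval_partitionable_block up)
    show "interval_partitionable 3 (\<U> \<inter> ?L)" by (rule interval_partitionable_large) auto
    have "Y \<notin> ?L" if "Y \<in> block a b c e" for Y and a b c e :: 5
      using card_block[OF that] by simp
    then show "(\<U> \<inter> block 0 1 3 4 \<union> \<U> \<inter> block 1 2 4 0 \<union> \<U> \<inter> block 2 3 0 1 \<union> \<U> \<inter> block 3 4 1 2 \<union>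
      \<U> \<inter> block 4 0 2 3) \<inter> (\<U> \<inter> ?L) = {}" by blast
  qed (simp_all add: Int_Un_distrib2 restrict blocks_disjoint)
  then show ?thesis using \<open>\<U> = ?R\<close> by simp
qed

section \<open>Stanley depth and depth in five variables\<close>

theorem theorem2p11:
  fixes I :: "(5, 'k::field) mpoly set"
  assumes "squarefree_monomial_ideal I"
  shows "sdepth (*) component I \<ge> depth (*) I"
proof -
  obtain \<U> where up: "upward_closed \<U>" and I: "I = polys_on \<U>"
    using squarefree_monomial_ideal_polys_on[OF assms] .
  have ideal: "is_ideal I" unfolding I by (rule is_ideal_polys_on[OF up])
  show ?thesis
  proof (cases "I = {0}")
    case True
    then show ?thesis by (simp add: sdepth_def)
  next
    case False
    then have ne: "\<U> \<noteq> {}" using I polys_on_empty by auto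
    have "enat (length fs) \<le> sdepth (*) component I"
      if fs: "set fs \<subseteq> graded_maximal_ideal" "regular_sequence (*) I fs" for fs
    proof -
      have ac: "koszul_acyclic (polys_on \<U> :: (5, 'k) mpoly set) i" if "i < length fs" for i
        using regular_sequence_koszul_acyclic[OF ideal fs that] by (simp only: I)
      \<comment> \<open>a regular sequence of length \<open>6\<close> or more would make degree \<open>5\<close> acyclic\<close>
      have "length fs \<le> 5"
        using not_koszul_acyclic_card[OF ne, where 'k = 'k] ac[of 5] by force
      then consider "length fs \<le> 3" | "length fs = 4" | "length fs = 5" by linarith
      then have "interval_partitionable (length fs) \<U>"
      proof cases
        case 1
        then show ?thesis
          using interval_partitionable_3[OF up] interval_partitionable_mono by blast
      next
        case 2
        then show ?thesis
          using interval_partitionable_if_acyclic_minus_1[OF up ne ac] by simp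
      next
        case 3
        then show ?thesis
          using interval_partitionable_if_acyclic[OF up ne ac] by simp
      qed
      then show ?thesis unfolding I by (rule sdepth_ge_interval_partitionable)
    qed
    then show ?thesis using False by (auto simp: depth_def intro!: Sup_least)
  qed
qed

end
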